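(* Consider the state evolution (SE) equations, for $t\ge1$, $$\mu^q(t)=\overline{\mathcal{E}}_{\rm out}(\mu^z(t)),\qquad \mu^x(t+1,s)=\overline{\mathcal{E}}_{\rm in}(\mu^q(t),s),\qquad \mu^z(t+1)=\beta\,\overline{\mathcal{E}}_{\rm in}(\mu^q(t)),$$ with the functions defined in the context. Suppose that $\overline{\mathcal{E}}_{\rm in}(\mu)$ and $\overline{\mathcal{E}}_{\rm out}(\mu)$ are continuous. Then the SE equations have at least one fixed point with $0\le\mu^z\le\mu^z_{\rm init}$. Also: (a) With the "hi" initial condition $\mu^z(1)=\mu^z_{\rm hi}(1)=\mu^z_{\rm init}$, the resulting sequences $\mu^z_{\rm hi}(t)$, $\mu^x_{\rm hi}(t,s)$ and $\mu^q_{\rm hi}(t)$ decrease monotonically (in the non-strict sense) to the largest fixed point of the SE equations. (b) With the "lo" initial condition $\mu^z(1)=\mu^z_{\rm lo}(1)=0$, the resulting sequences $\mu^z_{\rm lo}(t)$, $\mu^x_{\rm lo}(t,s)$ and $\mu^q_{\rm lo}(t)$ increase monotonically (in the non-strict sense) to the smallest fixed point of the SE equations.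
   Context: Let $p_X$ be a scalar distribution with variance $\mu^x_{\rm init}$, $p_S$ a distribution of a random variable $s$ with $s>0$ almost surely, $p_{Y|Z}(y|z)$ a scalar conditional distribution, and $\beta\ge0$. **Input function.** For $x\sim p_X$ and $q=x+v$, $v\sim\mathcal{N}(0,\mu)$ independent of $x$, let $\mathcal{E}_{\rm in}(q,\mu)$ be the conditional variance of $x$ given $q$. Define $\overline{\mathcal{E}}_{\rm in}(\mu,s)=\mathbf{E}[\mathcal{E}_{\rm in}(q,\mu/s)\mid s]$ and $\overline{\mathcal{E}}_{\rm in}(\mu)=\mathbf{E}[s\,\mathcal{E}_{\rm in}(q,\mu/s)]$, where $s\sim p_S$, $x\sim p_X$ are independent and $q=x+v$ with $v\sim\mathcal{N}(0,\mu/s)$ given $s$, independent of $x$. **Output function.** Let $\phi(v;\mu)=\frac1{\sqrt{2\pi\mu}}\exp(-|v|^2/(2\mu))$, $p_{Y|\widehat Z,\mu}(y|\widehat z,\mu)=\int p_{Y|Z}(y|z)\phi(z-\widehat z;\mu)\,dz$ (for $\mu=0$ this is $p_{Y|Z}(y|\widehat z)$), and $D_2(y,\widehat z,\mu)=-\frac{\partial^2}{\partial\widehat z^2}\log p_{Y|\widehat Z,\mu}(y|\widehat z,\mu)$. Let $\mu^z_{\rm init}=\beta\,\mathbf{E}(s)\,\mu^x_{\rm init}$. For $0\le\mu\le\mu^z_{\rm init}$ define $\overline{\mathcal{E}}_{\rm out}(\mu)=1/\mathbf{E}[D_2(y,\widehat z,\mu)]$, where $(z,\widehat z)\sim\mathcal{N}(0,P_z(\mu))$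 with $$P_z(\mu)=\begin{pmatrix}\mu^z_{\rm init}&\mu^z_{\rm init}-\mu\\ \mu^z_{\rm init}-\mu&\mu^z_{\rm init}-\mu\end{pmatrix},$$ and, given $z$, $y\sim p_{Y|Z}(\cdot|z)$. **Fixed points.** The SE equations are equivalent to the single recursion $\mu^z(t+1)=\beta\,\overline{\mathcal{E}}_{\rm in}[\overline{\mathcal{E}}_{\rm out}(\mu^z(t))]$. A fixed point is a value $\mu^z\in[0,\mu^z_{\rm init}]$ with $\mu^z=\beta\,\overline{\mathcal{E}}_{\rm in}[\overline{\mathcal{E}}_{\rm out}(\mu^z)]$, together with the corresponding values $\mu^q=\overline{\mathcal{E}}_{\rm out}(\mu^z)$ and $\mu^x(s)=\overline{\mathcal{E}}_{\rm in}(\mu^q,s)$. "Largest" and "smallest" refer to the value of $\mu^z$. *)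

theory Defs
  imports "HOL-Probability.Probability"
begin

section \<open>Gaussian laws\<close>

text \<open>The centred normal law with variance \<open>v \<ge> 0\<close>, including the degenerate case \<open>v = 0\<close>.\<close>

definition gaussian :: "real \<Rightarrow> real measure" where
  "gaussian v = (if v = 0 then return borel 0
                 else density lborel (\<lambda>x. ennreal (normal_density 0 (sqrt v) x)))"

text \<open>
  The bivariate normal law \<open>N(0, P)\<close> has to be available for singular \<open>P\<close>, so it is
  defined as the law of \<open>A (g, h)\<close>, where \<open>g, h\<close> are independent standard normal and
  \<open>A\<close> is the triangular factor with \<open>A A\<^sup>T = P\<close>.
  The convention \<open>x / 0 = 0\<close> gives the right factor when \<open>P $ 2 $ 2 = 0\<close>, since then
  \<open>P $ 1 $ 2 = 0\<close>.
\<close>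

definition chol2 :: "real^2^2 \<Rightarrow> real^2^2" where
  "chol2 P = vector [vector [sqrt (P$1$1 - (P$1$2)\<^sup>2 / P$2$2), P$1$2 / sqrt (P$2$2)],
                     vector [0,                                sqrt (P$2$2)]]"

lemma chol2_factor:
  assumes "P$1$2 = P$2$1" "P$1$1 \<ge> 0" "P$2$2 \<ge> 0" "(P$1$2)\<^sup>2 \<le> P$1$1 * P$2$2"
  shows "chol2 P ** transpose (chol2 P) = P"
proof (cases "P$2$2 = 0")
  case True
  then have "P$1$2 = 0" "P$2$1 = 0" using assms by auto
  with True assms show ?thesis
    by (simp add: vec_eq_iff forall_2 chol2_def matrix_matrix_mult_def transpose_def sum_2)
next
  case False
  with assms have pos: "P$2$2 > 0" by simp
  then have "(P$1$2)\<^sup>2 / P$2$2 \<le> P$1$1" using assms(4) by (simp add: field_simps)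
  then show ?thesis using pos assms(1)
    by (simp add: vec_eq_iff forall_2 chol2_def matrix_matrix_mult_def transpose_def sum_2
        power2_eq_square)
qed

definition bivariate_gaussian :: "real^2^2 \<Rightarrow> (real \<times> real) measure" where
  "bivariate_gaussian P =
     distr (gaussian 1 \<Otimes>\<^sub>M gaussian 1) (borel \<Otimes>\<^sub>M borel)
       (\<lambda>(g, h). (chol2 P $ 1 $ 1 * g + chol2 P $ 1 $ 2 * h,
                  chol2 P $ 2 $ 1 * g + chol2 P $ 2 $ 2 * h))"


section \<open>Input function\<close>

definition cond_variance :: "'a measure \<Rightarrow> 'a measure \<Rightarrow> ('a \<Rightarrow> real) \<Rightarrow> 'a \<Rightarrow> real" where
  "cond_variance M F X =
     real_cond_exp M F (\<lambda>\<omega>. (X \<omega> - real_cond_exp M F X \<omega>)\<^sup>2)"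

text \<open>The space carrying the independent pair \<open>(x, v)\<close>, \<open>x \<sim> pX\<close>, \<open>v \<sim> N(0, \<mu>)\<close>.\<close>

definition input_space :: "real measure \<Rightarrow> real \<Rightarrow> (real \<times> real) measure" where
  "input_space pX \<mu> = pX \<Otimes>\<^sub>M gaussian \<mu>"

text \<open>The conditional variance of \<open>x\<close> given \<open>q = x + v\<close>, as a random variable.\<close>

definition E_in :: "real measure \<Rightarrow> real \<Rightarrow> real \<times> real \<Rightarrow> real" where
  "E_in pX \<mu> =
     cond_variance (input_space pX \<mu>)
       (vimage_algebra (space (input_space pX \<mu>)) (\<lambda>(x, v). x + v) borel) fst"

text \<open>
  Given \<open>s\<close>, the pair \<open>(x, v)\<close> has the law \<open>input_space pX (\<mu> / s)\<close>, so an expectation over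
  \<open>(s, x, v)\<close> is an integral over \<open>s\<close> of integrals with respect to these laws.
\<close>

definition Ebar_in_s :: "real measure \<Rightarrow> real \<Rightarrow> real \<Rightarrow> real" where
  "Ebar_in_s pX \<mu> s = (\<integral>\<omega>. E_in pX (\<mu> / s) \<omega> \<partial>input_space pX (\<mu> / s))"

definition Ebar_in :: "real measure \<Rightarrow> real measure \<Rightarrow> real \<Rightarrow> real" where
  "Ebar_in pX pS \<mu> = (\<integral>s. (\<integral>\<omega>. s * E_in pX (\<mu> / s) \<omega> \<partial>input_space pX (\<mu> / s)) \<partial>pS)"


section \<open>Output function\<close>

text \<open>
  The conditional law of \<open>y\<close> given \<open>z\<close> has the density \<open>p y z\<close> with respect to a reference
  measure \<open>\<nu>\<close>: Lebesgue measure for a continuous output, the counting measure on a countable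
  set for a discrete one.
\<close>

definition conditional_density :: "real measure \<Rightarrow> (real \<Rightarrow> real \<Rightarrow> real) \<Rightarrow> bool" where
  "conditional_density \<nu> p \<longleftrightarrow>
     sigma_finite_measure \<nu> \<and> sets \<nu> = sets borel \<and>
     (\<lambda>(y, z). p y z) \<in> borel_measurable (borel \<Otimes>\<^sub>M borel) \<and>
     (\<forall>y z. 0 \<le> p y z) \<and>
     (\<forall>z. (\<integral>\<^sup>+y. ennreal (p y z) \<partial>\<nu>) = 1)"

definition p_Y_Zhat :: "(real \<Rightarrow> real \<Rightarrow> real) \<Rightarrow> real \<Rightarrow> real \<Rightarrow> real \<Rightarrow> real" where
  "p_Y_Zhat p y zh \<mu> =
     (if \<mu> = 0 then p y zh
      else (\<integral>z. p y z * normal_density 0 (sqrt \<mu>) (z - zh) \<partial>lborel))"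

definition D2 :: "(real \<Rightarrow> real \<Rightarrow> real) \<Rightarrow> real \<Rightarrow> real \<Rightarrow> real \<Rightarrow> real" where
  "D2 p y zh \<mu> = - deriv (deriv (\<lambda>u. ln (p_Y_Zhat p y u \<mu>))) zh"

definition P_z :: "real \<Rightarrow> real \<Rightarrow> real^2^2" where
  "P_z \<mu>init \<mu> = vector [vector [\<mu>init,     \<mu>init - \<mu>],
                         vector [\<mu>init - \<mu>, \<mu>init - \<mu>]]"

text \<open>The joint law of \<open>((z, zh), y)\<close>.\<close>

definition output_space ::
    "real measure \<Rightarrow> (real \<Rightarrow> real \<Rightarrow> real) \<Rightarrow> real \<Rightarrow> real \<Rightarrow> ((real \<times> real) \<times> real) measure" where
  "output_space \<nu> p \<mu>init \<mu> =
     density (bivariate_gaussian (P_z \<mu>init \<mu>) \<Otimes>\<^sub>M \<nu>) (\<lambda>((z, zh), y). ennreal (p y z))"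

definition mean_D2 ::
    "real measure \<Rightarrow> (real \<Rightarrow> real \<Rightarrow> real) \<Rightarrow> real \<Rightarrow> real \<Rightarrow> real" where
  "mean_D2 \<nu> p \<mu>init \<mu> = (\<integral>((z, zh), y). D2 p y zh \<mu> \<partial>output_space \<nu> p \<mu>init \<mu>)"

definition Ebar_out ::
    "real measure \<Rightarrow> (real \<Rightarrow> real \<Rightarrow> real) \<Rightarrow> real \<Rightarrow> real \<Rightarrow> real" where
  "Ebar_out \<nu> p \<mu>init \<mu> = 1 / mean_D2 \<nu> p \<mu>init \<mu>"


section \<open>State evolution\<close>

definition mu_x_init :: "real measure \<Rightarrow> real" where
  "mu_x_init pX = (\<integral>x. (x - (\<integral>x'. x' \<partial>pX))\<^sup>2 \<partial>pX)"

definition mu_z_init :: "real measure \<Rightarrow> real measure \<Rightarrow> real \<Rightarrow> real" where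
  "mu_z_init pX pS \<beta> = \<beta> * (\<integral>s. s \<partial>pS) * mu_x_init pX"

definition SE_equations ::
    "real measure \<Rightarrow> real measure \<Rightarrow> real measure \<Rightarrow> (real \<Rightarrow> real \<Rightarrow> real) \<Rightarrow> real \<Rightarrow>
     (nat \<Rightarrow> real) \<Rightarrow> (nat \<Rightarrow> real \<Rightarrow> real) \<Rightarrow> (nat \<Rightarrow> real) \<Rightarrow> bool" where
  "SE_equations pX pS \<nu> p \<beta> \<mu>q \<mu>x \<mu>z \<longleftrightarrow>
     (\<forall>t\<ge>1. \<mu>q t = Ebar_out \<nu> p (mu_z_init pX pS \<beta>) (\<mu>z t) \<and>
            (\<forall>s>0. \<mu>x (t + 1) s = Ebar_in_s pX (\<mu>q t) s) \<and>
            \<mu>z (t + 1) = \<beta> * Ebar_in pX pS (\<mu>q t))"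

definition SE_fixed_point ::
    "real measure \<Rightarrow> real measure \<Rightarrow> real measure \<Rightarrow> (real \<Rightarrow> real \<Rightarrow> real) \<Rightarrow> real \<Rightarrow>
     real \<Rightarrow> (real \<Rightarrow> real) \<Rightarrow> real \<Rightarrow> bool" where
  "SE_fixed_point pX pS \<nu> p \<beta> mq mx mz \<longleftrightarrow>
     0 \<le> mz \<and> mz \<le> mu_z_init pX pS \<beta> \<and>
     mq = Ebar_out \<nu> p (mu_z_init pX pS \<beta>) mz \<and>
     (\<forall>s>0. mx s = Ebar_in_s pX mq s) \<and>
     mz = \<beta> * Ebar_in pX pS mq"

definition largest_SE_fixed_point ::
    "real measure \<Rightarrow> real measure \<Rightarrow> real measure \<Rightarrow> (real \<Rightarrow> real \<Rightarrow> real) \<Rightarrow> real \<Rightarrow>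
     real \<Rightarrow> (real \<Rightarrow> real) \<Rightarrow> real \<Rightarrow> bool" where
  "largest_SE_fixed_point pX pS \<nu> p \<beta> mq mx mz \<longleftrightarrow>
     SE_fixed_point pX pS \<nu> p \<beta> mq mx mz \<and>
     (\<forall>mq' mx' mz'. SE_fixed_point pX pS \<nu> p \<beta> mq' mx' mz' \<longrightarrow> mz' \<le> mz)"

definition smallest_SE_fixed_point ::
    "real measure \<Rightarrow> real measure \<Rightarrow> real measure \<Rightarrow> (real \<Rightarrow> real \<Rightarrow> real) \<Rightarrow> real \<Rightarrow>
     real \<Rightarrow> (real \<Rightarrow> real) \<Rightarrow> real \<Rightarrow> bool" where
  "smallest_SE_fixed_point pX pS \<nu> p \<beta> mq mx mz \<longleftrightarrow>
     SE_fixed_point pX pS \<nu> p \<beta> mq mx mz \<and>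
     (\<forall>mq' mx' mz'. SE_fixed_point pX pS \<nu> p \<beta> mq' mx' mz' \<longrightarrow> mz \<le> mz')"

text \<open>
  The equations determine \<open>\<mu>q t\<close> and \<open>\<mu>z t\<close> from \<open>t = 1\<close> on, but \<open>\<mu>x t s\<close> only from \<open>t = 2\<close> on.
\<close>

definition SE_decreases_to ::
    "(nat \<Rightarrow> real) \<Rightarrow> (nat \<Rightarrow> real \<Rightarrow> real) \<Rightarrow> (nat \<Rightarrow> real) \<Rightarrow>
     real \<Rightarrow> (real \<Rightarrow> real) \<Rightarrow> real \<Rightarrow> bool" where
  "SE_decreases_to \<mu>q \<mu>x \<mu>z mq mx mz \<longleftrightarrow>
     antimono_on {1..} \<mu>z \<and> \<mu>z \<longlonglongrightarrow> mz \<and>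
     (\<forall>s>0. antimono_on {2..} (\<lambda>t. \<mu>x t s) \<and> (\<lambda>t. \<mu>x t s) \<longlonglongrightarrow> mx s) \<and>
     antimono_on {1..} \<mu>q \<and> \<mu>q \<longlonglongrightarrow> mq"

definition SE_increases_to ::
    "(nat \<Rightarrow> real) \<Rightarrow> (nat \<Rightarrow> real \<Rightarrow> real) \<Rightarrow> (nat \<Rightarrow> real) \<Rightarrow>
     real \<Rightarrow> (real \<Rightarrow> real) \<Rightarrow> real \<Rightarrow> bool" where
  "SE_increases_to \<mu>q \<mu>x \<mu>z mq mx mz \<longleftrightarrow>
     mono_on {1..} \<mu>z \<and> \<mu>z \<longlonglongrightarrow> mz \<and>
     (\<forall>s>0. mono_on {2..} (\<lambda>t. \<mu>x t s) \<and> (\<lambda>t. \<mu>x t s) \<longlonglongrightarrow> mx s) \<and>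
     mono_on {1..} \<mu>q \<and> \<mu>q \<longlonglongrightarrow> mq"

end

theory Submission
  imports Defs
begin

text \<open>
  Both functions are monotone, so that \<open>F(\<mu>) = \<beta> Ebar_in(Ebar_out(\<mu>))\<close> is a continuous increasing
  self-map of \<open>[0, \<mu>z_init]\<close>; iterating it from an endpoint gives a monotone sequence that converges
  to the extreme fixed point.

  Input: the mean conditional variance is the least mean square error of an estimator of \<open>x\<close> from
  \<open>q\<close>. Noise of variance \<open>b \<ge> a\<close> is noise of variance \<open>a\<close> plus an independent part, and for each
  value of that part the estimator for \<open>b\<close> is an estimator at noise level \<open>a\<close>. Constant estimators
  give the bound by the variance of \<open>x\<close>.

  Output: write \<open>P(y, u)\<close> for the density of \<open>y\<close> given \<open>zh = u\<close>. Since
  \<open>D2 = (P'/P)\<^sup>2 - P''/P\<close> and \<open>\<integral> P'' d\<nu> = 0\<close>, the mean of \<open>D2\<close> is the Fisher information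
  \<open>E[\<integral> P'\<^sup>2 / P d\<nu>]\<close>. The density \<open>P\<close> at level \<open>b\<close> is a Gaussian mixture of translates of \<open>P\<close> at
  level \<open>a \<le> b\<close>, so convexity of \<open>(x, y) \<mapsto> x\<^sup>2 / y\<close> makes the Fisher information decrease in \<open>\<mu>\<close>.
\<close>

section \<open>Gaussian laws\<close>

text \<open>Three obstacles shape the proof. Continuity is assumed for \<open>Ebar_in\<close>, an
  average over \<open>s\<close>, whereas \<open>\<mu>x t s\<close> has to converge for each single
  \<open>s\<close>; hence the mean square error is itself shown to be continuous in the noise
  variance. This is done away from variance 0, and it applies because \<open>Ebar_out\<close> is
  increasing with a positive value at 0, so that the noise levels along an orbit stay in a compact
  interval of positive numbers. On the output side \<open>p y z\<close> is a density in
  \<open>y\<close>, not in \<open>z\<close>: for fixed \<open>y\<close> it need not be integrable in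
  \<open>z\<close>, and only for almost all \<open>y\<close> can it be integrated against every
  Gaussian. Derivatives are therefore exchanged with the integral over \<open>z\<close> alone, at
  fixed \<open>y\<close>; that the second derivative integrates to 0 over \<open>y\<close> is read
  off from two Gaussian moments. Finally, the comparisons are made between nonnegative integrals in
  \<open>ennreal\<close>, where iterated integrals may be swapped without integrability, and are
  carried back to the reals at the end.\<close>

definition phi :: "real \<Rightarrow> real \<Rightarrow> real" where
  "phi \<mu> = normal_density 0 (sqrt \<mu>)"

lemma phi_eq: "0 < \<mu> \<Longrightarrow> phi \<mu> x = exp (- x\<^sup>2 / (2 * \<mu>)) / sqrt (2 * pi * \<mu>)"
  by (simp add: phi_def normal_density_def)

lemma phi_measurable [measurable]: "phi \<mu> \<in> borel_measurable borel"
  by (simp add: phi_def)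

lemma phi_pos: "0 < \<mu> \<Longrightarrow> 0 < phi \<mu> x"
  by (simp add: phi_def normal_density_pos)

lemma phi_nonneg [simp]: "0 \<le> phi \<mu> x"
  by (simp add: phi_def)

lemma phi_le_phi_0: "0 < \<mu> \<Longrightarrow> phi \<mu> x \<le> phi \<mu> 0"
  by (simp add: phi_eq divide_right_mono)

text \<open>Majorant for dominated convergence while the variance runs through
  \<open>[a, b]\<close>: the exponential is largest at \<open>b\<close>, the prefactor at
  \<open>a\<close>, and \<open>sqrt (b / a)\<close> is the quotient of the two prefactors.\<close>

lemma phi_mono_variance:
  assumes "0 < a" "a \<le> \<mu>" "\<mu> \<le> b"
  shows "phi \<mu> x \<le> sqrt (b / a) * phi b x"
proof -
  have "exp (- x\<^sup>2 / (2 * \<mu>)) \<le> exp (- x\<^sup>2 / (2 * b))"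
    using assms by (simp add: frac_le)
  moreover have "1 / sqrt (2 * pi * \<mu>) \<le> 1 / sqrt (2 * pi * a)"
    using assms by (simp add: frac_le)
  ultimately have "phi \<mu> x \<le> exp (- x\<^sup>2 / (2 * b)) * (1 / sqrt (2 * pi * a))"
    using assms mult_mono[of "exp (- x\<^sup>2 / (2 * \<mu>))" "exp (- x\<^sup>2 / (2 * b))"
        "1 / sqrt (2 * pi * \<mu>)" "1 / sqrt (2 * pi * a)"]
    by (simp add: phi_eq)
  also have "\<dots> = sqrt (b / a) * phi b x"
    using assms by (simp add: phi_eq real_sqrt_mult real_sqrt_divide)
  finally show ?thesis .
qed

lemma phi_integral:
  assumes "0 < \<mu>"
  shows "integrable lborel (\<lambda>z. phi \<mu> (z - u))" "(\<integral>z. phi \<mu> (z - u) \<partial>lborel) = 1"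
    "integrable lborel (\<lambda>z. phi \<mu> (u - z))" "(\<integral>z. phi \<mu> (u - z) \<partial>lborel) = 1"
proof -
  have eq: "phi \<mu> (z - u) = normal_density u (sqrt \<mu>) z" for z
    by (simp add: phi_def normal_density_def)
  have eq': "phi \<mu> (u - z) = normal_density u (sqrt \<mu>) z" for z
    by (simp add: phi_def normal_density_def power2_commute)
  show "integrable lborel (\<lambda>z. phi \<mu> (z - u))" "(\<integral>z. phi \<mu> (z - u) \<partial>lborel) = 1"
    "integrable lborel (\<lambda>z. phi \<mu> (u - z))" "(\<integral>z. phi \<mu> (u - z) \<partial>lborel) = 1"
    using assms by (simp_all add: eq eq')
qed

lemma phi_second_moment:
  assumes "0 < \<mu>"
  shows "(\<integral>\<^sup>+z. ennreal ((z - u)\<^sup>2 * phi \<mu> (z - u)) \<partial>lborel) = ennreal \<mu>"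
proof -
  have "has_bochner_integral lborel (\<lambda>z. (z - u)\<^sup>2 * phi \<mu> (z - u)) \<mu>"
    using normal_moment_even[of "sqrt \<mu>" u 1] assms
    by (simp add: phi_def normal_density_def mult.commute)
  then show ?thesis
    by (subst nn_integral_eq_integral) (auto simp: has_bochner_integral_iff)
qed

lemma nn_integral_phi:
  assumes "0 < \<mu>"
  shows "(\<integral>\<^sup>+z. ennreal (phi \<mu> (z - u)) \<partial>lborel) = 1" "(\<integral>\<^sup>+z. ennreal (phi \<mu> (u - z)) \<partial>lborel) = 1"
  using phi_integral[OF assms, of u] by (simp_all add: nn_integral_eq_integral)

lemma gaussian_eq_density: "\<mu> \<noteq> 0 \<Longrightarrow> gaussian \<mu> = density lborel (\<lambda>x. ennreal (phi \<mu> x))"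
  by (simp add: gaussian_def phi_def)

lemma gaussian_0: "gaussian 0 = return borel 0"
  by (simp add: gaussian_def)

lemma sets_gaussian [simp, measurable_cong]: "sets (gaussian \<mu>) = sets borel"
  by (simp add: gaussian_def)

lemma space_gaussian [simp]: "space (gaussian \<mu>) = UNIV"
  by (simp add: gaussian_def)

text \<open>\<open>normal_density\<close> sees the standard deviation only through its square. This
  serves the measurability in \<open>s\<close> of quantities at variance \<open>\<mu> / s\<close>:
  negative \<open>s\<close> form a null set but are still arguments of the function.\<close>

lemma gaussian_uminus: "gaussian (- \<mu>) = gaussian \<mu>"
  by (auto simp: gaussian_def normal_density_def fun_eq_iff real_sqrt_minus)

lemma gaussian_abs: "gaussian \<bar>\<mu>\<bar> = gaussian \<mu>"
  by (simp add: abs_if gaussian_uminus)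

lemma prob_space_gaussian [simp]: "0 \<le> \<mu> \<Longrightarrow> prob_space (gaussian \<mu>)"
  by (cases "\<mu> = 0")
    (auto simp: gaussian_def intro!: prob_space_return prob_space_normal_density)

lemma nn_integral_gaussian:
  assumes "0 < \<mu>" "f \<in> borel_measurable borel"
  shows "(\<integral>\<^sup>+x. f x \<partial>gaussian \<mu>) = (\<integral>\<^sup>+x. ennreal (phi \<mu> x) * f x \<partial>lborel)"
  using assms by (simp add: gaussian_eq_density nn_integral_density)

lemma nn_integral_gaussian_translate:
  assumes "0 < \<mu>" and [measurable]: "f \<in> borel_measurable borel"
  shows "(\<integral>\<^sup>+w. f (u + w) \<partial>gaussian \<mu>) = (\<integral>\<^sup>+z. ennreal (phi \<mu> (z - u)) * f z \<partial>lborel)"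
proof -
  have "(\<integral>\<^sup>+w. f (u + w) \<partial>gaussian \<mu>) = (\<integral>\<^sup>+w. ennreal (phi \<mu> w) * f (u + w) \<partial>lborel)"
    using assms(1) by (subst nn_integral_gaussian) auto
  also have "\<dots> = (\<integral>\<^sup>+z. ennreal (phi \<mu> (z - u)) * f z \<partial>lborel)"
    by (subst (2) lborel_distr_plus[of u, symmetric], subst nn_integral_distr) auto
  finally show ?thesis .
qed

text \<open>Variances of independent centred normals add. Degenerate summands are included because
  the variances \<open>b - a\<close> and \<open>m - b\<close> that occur later may be 0; they have
  no density and are treated apart.\<close>

lemma nn_integral_gaussian_add:
  assumes "0 \<le> a" "0 \<le> b" and [measurable]: "f \<in> borel_measurable borel"
  shows "(\<integral>\<^sup>+x. \<integral>\<^sup>+y. f (x + y) \<partial>gaussian b \<partial>gaussian a) = (\<integral>\<^sup>+x. f x \<partial>gaussian (a + b))"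
proof (cases "a = 0 \<or> b = 0")
  case True
  interpret b: prob_space "gaussian b" by (simp add: assms)
  show ?thesis using True by (auto simp: gaussian_0 nn_integral_return)
next
  case False
  with assms have ab: "0 < a" "0 < b" by auto
  have fin: "finite_measure (density lborel (\<lambda>x. ennreal (phi c x)))" if "0 < c" for c
    using prob_space_gaussian[of c] that
    by (simp add: gaussian_eq_density prob_space_def)
  have "convolution (gaussian a) (gaussian b) = gaussian (a + b)"
    using ab conv_normal_density_zero_mean[of "sqrt a" "sqrt b"]
    by (simp add: gaussian_eq_density convolution_density fin ennreal_mult'[symmetric])
      (simp add: phi_def)
  then show ?thesis
    using nn_integral_convolution[of "gaussian a" "gaussian b" f] assms
    by (simp add: prob_space.finite_measure)
qed

lemma distr_gaussian_scale:
  assumes "0 \<le> c"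
  shows "distr (gaussian 1) borel (\<lambda>x. c * x) = gaussian (c\<^sup>2)"
proof (cases "c = 0")
  case True
  interpret prob_space "gaussian 1" by simp
  show ?thesis using True by (simp add: gaussian_0 distr_const)
next
  case False
  interpret prob_space "gaussian 1" by simp
  have "distributed (gaussian 1) lborel (\<lambda>x. x) (normal_density 0 1)"
    using distr_id2[of borel "gaussian 1"] by (auto simp: distributed_def gaussian_def cong: distr_cong)
  then have "distributed (gaussian 1) lborel (\<lambda>x. c * x) (normal_density 0 c)"
    using normal_density_affine[of "\<lambda>x. x" 0 1 c 0] False assms by simp
  then have "distr (gaussian 1) lborel (\<lambda>x. c * x) = density lborel (normal_density 0 c)"
    by (simp add: distributed_def)
  then show ?thesis using False assms by (simp add: gaussian_def cong: distr_cong)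
qed

text \<open>Both entries in the second column of the triangular factor of \<open>P_z\<close> are
  equal, so \<open>z\<close> is \<open>zh\<close> plus an independent normal variable of variance
  \<open>\<mu>\<close>.\<close>

lemma nn_integral_bivariate_gaussian_P_z:
  assumes "0 < \<mu>" "\<mu> \<le> m" and [measurable]: "f \<in> borel_measurable (borel \<Otimes>\<^sub>M borel)"
  shows "(\<integral>\<^sup>+w. f w \<partial>bivariate_gaussian (P_z m \<mu>))
    = (\<integral>\<^sup>+u. \<integral>\<^sup>+w. f (u + w, u) \<partial>gaussian \<mu> \<partial>gaussian (m - \<mu>))"
proof -
  interpret g1: prob_space "gaussian 1" by simp
  interpret pair_prob_space "gaussian 1" "gaussian 1" ..
  have scale: "(\<integral>\<^sup>+x. h (sqrt v * x) \<partial>gaussian 1) = (\<integral>\<^sup>+x. h x \<partial>gaussian v)"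
    if "0 \<le> v" "h \<in> borel_measurable borel" for v h
    using that by (subst distr_gaussian_scale[of "sqrt v", simplified, symmetric])
      (auto simp: nn_integral_distr)
  \<comment> \<open>For \<open>\<mu> = m\<close> the convention \<open>x / 0 = 0\<close> makes the
    first entry \<open>sqrt m\<close>, which is again \<open>sqrt \<mu>\<close>.\<close>
  have c: "chol2 (P_z m \<mu>) $ 1 $ 1 = sqrt \<mu>" "chol2 (P_z m \<mu>) $ 1 $ 2 = sqrt (m - \<mu>)"
     "chol2 (P_z m \<mu>) $ 2 $ 1 = 0" "chol2 (P_z m \<mu>) $ 2 $ 2 = sqrt (m - \<mu>)"
    using assms by (auto simp: chol2_def P_z_def power2_eq_square real_div_sqrt)
  have "(\<integral>\<^sup>+w. f w \<partial>bivariate_gaussian (P_z m \<mu>))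
      = (\<integral>\<^sup>+h. \<integral>\<^sup>+g. f (sqrt \<mu> * g + sqrt (m - \<mu>) * h, sqrt (m - \<mu>) * h) \<partial>gaussian 1 \<partial>gaussian 1)"
    unfolding bivariate_gaussian_def
    by (subst nn_integral_distr) (simp_all add: c nn_integral_snd[symmetric] case_prod_beta)
  also have "\<dots> = (\<integral>\<^sup>+h. \<integral>\<^sup>+g. f (g + sqrt (m - \<mu>) * h, sqrt (m - \<mu>) * h) \<partial>gaussian \<mu> \<partial>gaussian 1)"
    using assms by (subst scale[of \<mu> "\<lambda>g. f (g + c, d)" for c d]) auto
  also have "\<dots> = (\<integral>\<^sup>+u. \<integral>\<^sup>+w. f (w + u, u) \<partial>gaussian \<mu> \<partial>gaussian (m - \<mu>))"
    using assms prob_space_imp_sigma_finite[OF prob_space_gaussian[of \<mu>]]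
    by (subst scale[of "m - \<mu>" "\<lambda>u. \<integral>\<^sup>+w. f (w + u, u) \<partial>gaussian \<mu>"])
      (auto intro!: sigma_finite_measure.borel_measurable_nn_integral)
  finally show ?thesis by (simp add: add.commute)
qed

section \<open>Input function\<close>

lemma abs_power_le_one_plus_square:
  assumes "k \<le> 2"
  shows "\<bar>x :: real\<bar> ^ k \<le> 1 + x\<^sup>2"
proof (cases "\<bar>x\<bar> \<le> 1")
  case True
  then show ?thesis by (smt (verit) power_le_one abs_ge_zero zero_le_power2)
next
  case False
  then have "\<bar>x\<bar> ^ k \<le> \<bar>x\<bar>\<^sup>2" using assms by (intro power_increasing) auto
  then show ?thesis by simp
qed

definition mmse :: "real measure \<Rightarrow> real \<Rightarrow> real" where
  "mmse pX \<mu> = (\<integral>\<omega>. E_in pX \<mu> \<omega> \<partial>input_space pX \<mu>)"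

lemma Ebar_in_s_eq_mmse: "Ebar_in_s pX \<mu> s = mmse pX (\<mu> / s)"
  by (simp add: Ebar_in_s_def mmse_def)

lemma Ebar_in_eq_mmse: "Ebar_in pX pS \<mu> = (\<integral>s. s * mmse pX (\<mu> / s) \<partial>pS)"
  by (simp add: Ebar_in_def mmse_def)

lemma mmse_abs: "mmse pX \<bar>\<mu>\<bar> = mmse pX \<mu>"
  by (simp add: mmse_def E_in_def input_space_def gaussian_abs)

text \<open>Not normalised: the posterior moments of \<open>x\<close> given \<open>q\<close> are ratios with the case \<open>k = 0\<close>.\<close>

definition posterior_moment :: "real measure \<Rightarrow> nat \<Rightarrow> real \<Rightarrow> real \<Rightarrow> real" where
  "posterior_moment pX k \<mu> q = (\<integral>x. x ^ k * phi \<mu> (q - x) \<partial>pX)"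

definition posterior_mean :: "real measure \<Rightarrow> real \<Rightarrow> real \<Rightarrow> real" where
  "posterior_mean pX \<mu> q = posterior_moment pX 1 \<mu> q / posterior_moment pX 0 \<mu> q"

section \<open>Posterior moments and the joint law of signal and observation\<close>

locale square_integrable_law = real_distribution pX for pX :: "real measure" +
  assumes square_integrable: "integrable pX (\<lambda>x. x\<^sup>2)"
begin

lemma integrable_power:
  assumes "k \<le> 2"
  shows "integrable pX (\<lambda>x. x ^ k)"
proof (rule Bochner_Integration.integrable_bound[of _ "\<lambda>x. 1 + x\<^sup>2"])
  show "AE x in pX. norm (x ^ k) \<le> norm (1 + x\<^sup>2)"
    using abs_power_le_one_plus_square[OF assms] by (simp add: power_abs)
qed (use square_integrable in auto)

lemma posterior_moment_measurable [measurable]: "posterior_moment pX k \<mu> \<in> borel_measurable borel"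
  unfolding posterior_moment_def by measurable

lemma posterior_mean_measurable [measurable]: "posterior_mean pX \<mu> \<in> borel_measurable borel"
  unfolding posterior_mean_def by measurable

sublocale pair: pair_sigma_finite lborel pX ..

context
  fixes \<mu> :: real
  assumes mu_pos: "0 < \<mu>"
begin

lemma integrable_posterior_moment:
  assumes "k \<le> 2"
  shows "integrable pX (\<lambda>x. x ^ k * phi \<mu> (q - x))"
proof (rule Bochner_Integration.integrable_bound[of _ "\<lambda>x. phi \<mu> 0 * x ^ k"])
  show "AE x in pX. norm (x ^ k * phi \<mu> (q - x)) \<le> norm (phi \<mu> 0 * x ^ k)"
    using phi_le_phi_0[OF mu_pos]
    by (auto simp: abs_mult mult.commute[of "phi \<mu> 0"] intro!: AE_I2 mult_left_mono)
qed (use integrable_power[OF assms] in auto)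

text \<open>The density of \<open>q\<close> has no zeros because the Gaussian has none and
  \<open>pX\<close> has mass 1. Hence the posterior mean is a genuine quotient for every
  \<open>q\<close>; on the output side the corresponding denominator can vanish.\<close>

lemma posterior_moment_0_pos: "0 < posterior_moment pX 0 \<mu> q"
proof -
  have "\<not> (AE x in pX. phi \<mu> (q - x) = 0)"
    using phi_pos[OF mu_pos] by (auto simp: less_le AE_False)
  then show ?thesis
    using integrable_posterior_moment[of 0 q]
      integral_nonneg_eq_0_iff_AE[of pX "\<lambda>x. phi \<mu> (q - x)"]
    by (auto simp: posterior_moment_def less_le)
qed

text \<open>Completing the square in \<open>c\<close>. Only the last term depends on
  \<open>c\<close>, so this one identity yields the optimality of the posterior mean, the
  Cauchy-Schwarz bound on the first moment and a closed form of the mean square error.\<close>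

lemma posterior_square_error:
  "integrable pX (\<lambda>x. (x - c)\<^sup>2 * phi \<mu> (q - x))"
  "(\<integral>x. (x - c)\<^sup>2 * phi \<mu> (q - x) \<partial>pX) =
    posterior_moment pX 2 \<mu> q - (posterior_moment pX 1 \<mu> q)\<^sup>2 / posterior_moment pX 0 \<mu> q
    + posterior_moment pX 0 \<mu> q * (c - posterior_mean pX \<mu> q)\<^sup>2"
proof -
  have eq: "(x - c)\<^sup>2 * phi \<mu> (q - x) =
     x\<^sup>2 * phi \<mu> (q - x) - 2 * c * (x ^ 1 * phi \<mu> (q - x)) + c\<^sup>2 * (x ^ 0 * phi \<mu> (q - x))" for x
    by (simp add: power2_eq_square algebra_simps)
  note int = integrable_posterior_moment[of 2 q] integrable_posterior_moment[of 1 q]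
    integrable_posterior_moment[of 0 q]
  show "integrable pX (\<lambda>x. (x - c)\<^sup>2 * phi \<mu> (q - x))"
    unfolding eq using int by auto
  have "(\<integral>x. (x - c)\<^sup>2 * phi \<mu> (q - x) \<partial>pX) =
    posterior_moment pX 2 \<mu> q - 2 * c * posterior_moment pX 1 \<mu> q + c\<^sup>2 * posterior_moment pX 0 \<mu> q"
    unfolding eq posterior_moment_def using int by simp
  also have "\<dots> = posterior_moment pX 2 \<mu> q - (posterior_moment pX 1 \<mu> q)\<^sup>2 / posterior_moment pX 0 \<mu> q
    + posterior_moment pX 0 \<mu> q * (c - posterior_mean pX \<mu> q)\<^sup>2"
    using posterior_moment_0_pos[of q]
    by (simp add: posterior_mean_def power2_eq_square field_simps)
  finally show "(\<integral>x. (x - c)\<^sup>2 * phi \<mu> (q - x) \<partial>pX) = \<dots>" .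
qed

lemma posterior_moment_square_le:
  "(posterior_moment pX 1 \<mu> q)\<^sup>2 / posterior_moment pX 0 \<mu> q \<le> posterior_moment pX 2 \<mu> q"
  using posterior_square_error(2)[of "posterior_mean pX \<mu> q" q]
    integral_nonneg_AE[where M = pX and f = "\<lambda>x. (x - posterior_mean pX \<mu> q)\<^sup>2 * phi \<mu> (q - x)"]
  by simp

lemma integrable_power_phi:
  assumes "k \<le> 2"
  shows "integrable (lborel \<Otimes>\<^sub>M pX) (\<lambda>(q, x). x ^ k * phi \<mu> (q - x))"
proof -
  interpret swap: pair_sigma_finite pX lborel ..
  \<comment> \<open>In this order Fubini's criterion is immediate: the inner integral over
    \<open>q\<close> of the Gaussian is 1.\<close>
  have "integrable (pX \<Otimes>\<^sub>M lborel) (\<lambda>(x, q). x ^ k * phi \<mu> (q - x))"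
    using integrable_power[OF assms] phi_integral[OF mu_pos]
    by (intro swap.Fubini_integrable) (auto simp: abs_mult)
  from swap.integrable_product_swap[OF this] show ?thesis
    by (simp add: case_prod_beta')
qed

lemma posterior_moment_integral:
  assumes "k \<le> 2"
  shows "integrable lborel (posterior_moment pX k \<mu>)"
    "(\<integral>q. posterior_moment pX k \<mu> q \<partial>lborel) = (\<integral>x. x ^ k \<partial>pX)"
proof -
  note int = integrable_power_phi[OF assms]
  show "integrable lborel (posterior_moment pX k \<mu>)"
    using pair.integrable_fst'[OF int] by (simp add: posterior_moment_def[abs_def])
  have "(\<integral>q. posterior_moment pX k \<mu> q \<partial>lborel) = (\<integral>x. (\<integral>q. x ^ k * phi \<mu> (q - x) \<partial>lborel) \<partial>pX)"
    using pair.Fubini_integral[OF int] by (simp add: posterior_moment_def)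
  then show "(\<integral>q. posterior_moment pX k \<mu> q \<partial>lborel) = (\<integral>x. x ^ k \<partial>pX)"
    using phi_integral[OF mu_pos] by simp
qed

lemma prob_space_input_space: "prob_space (input_space pX \<mu>)"
proof -
  interpret g: prob_space "gaussian \<mu>" using mu_pos by simp
  interpret p: pair_prob_space pX "gaussian \<mu>" ..
  show ?thesis unfolding input_space_def by (rule p.prob_space_axioms)
qed

lemma sets_input_space [simp, measurable_cong]:
  "sets (input_space pX \<mu>) = sets (borel \<Otimes>\<^sub>M borel)"
  unfolding input_space_def by (intro sets_pair_measure_cong) simp_all

lemma nn_integral_input_space:
  assumes [measurable]: "f \<in> borel_measurable (borel \<Otimes>\<^sub>M borel)"
  shows "(\<integral>\<^sup>+(x, v). f (x + v, x) \<partial>input_space pX \<mu>)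
    = (\<integral>\<^sup>+q. \<integral>\<^sup>+x. ennreal (phi \<mu> (q - x)) * f (q, x) \<partial>pX \<partial>lborel)"
proof -
  interpret g: prob_space "gaussian \<mu>" using mu_pos by simp
  have "(\<integral>\<^sup>+(x, v). f (x + v, x) \<partial>input_space pX \<mu>)
     = (\<integral>\<^sup>+x. \<integral>\<^sup>+v. f (x + v, x) \<partial>gaussian \<mu> \<partial>pX)"
    unfolding input_space_def by (subst g.nn_integral_fst[symmetric]) auto
  also have "\<dots> = (\<integral>\<^sup>+x. \<integral>\<^sup>+q. ennreal (phi \<mu> (q - x)) * f (q, x) \<partial>lborel \<partial>pX)"
    using mu_pos by (subst nn_integral_gaussian_translate[of \<mu> "\<lambda>q. f (q, x)" for x]) auto
  also have "\<dots> = (\<integral>\<^sup>+q. \<integral>\<^sup>+x. ennreal (phi \<mu> (q - x)) * f (q, x) \<partial>pX \<partial>lborel)"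
    by (subst pair.Fubini') auto
  finally show ?thesis .
qed

text \<open>Bayes' formula as a joint density of \<open>(q, x)\<close>. It extends the change of
  variables from nonnegative integrands to signed ones.\<close>

lemma distr_input_space:
  "distr (input_space pX \<mu>) (borel \<Otimes>\<^sub>M borel) (\<lambda>(x, v). (x + v, x))
    = density (lborel \<Otimes>\<^sub>M pX) (\<lambda>(q, x). ennreal (phi \<mu> (q - x)))"
proof (rule measure_eqI)
  fix A assume "A \<in> sets (distr (input_space pX \<mu>) (borel \<Otimes>\<^sub>M borel) (\<lambda>(x, v). (x + v, x)))"
  then have [measurable]: "A \<in> sets (borel \<Otimes>\<^sub>M borel)" by simp
  have "emeasure (distr (input_space pX \<mu>) (borel \<Otimes>\<^sub>M borel) (\<lambda>(x, v). (x + v, x))) A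
     = (\<integral>\<^sup>+(x, v). indicator A (x + v, x) \<partial>input_space pX \<mu>)"
    by (subst nn_integral_indicator[symmetric], simp, subst nn_integral_distr)
      (auto simp: case_prod_beta')
  also have "\<dots> = (\<integral>\<^sup>+q. \<integral>\<^sup>+x. ennreal (phi \<mu> (q - x)) * indicator A (q, x) \<partial>pX \<partial>lborel)"
    by (rule nn_integral_input_space) measurable
  also have "\<dots> = (\<integral>\<^sup>+(q, x). ennreal (phi \<mu> (q - x)) * indicator A (q, x) \<partial>(lborel \<Otimes>\<^sub>M pX))"
    by (subst nn_integral_fst[symmetric]) (auto simp: case_prod_beta')
  also have "\<dots> = emeasure (density (lborel \<Otimes>\<^sub>M pX) (\<lambda>(q, x). ennreal (phi \<mu> (q - x)))) A"
    by (subst emeasure_density) (auto simp: case_prod_beta' cong: sets_pair_measure_cong)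
  finally show "emeasure (distr (input_space pX \<mu>) (borel \<Otimes>\<^sub>M borel) (\<lambda>(x, v). (x + v, x))) A = \<dots>" .
qed (simp cong: sets_pair_measure_cong)

lemma integral_input_space:
  fixes f :: "real \<times> real \<Rightarrow> real"
  assumes [measurable]: "f \<in> borel_measurable (borel \<Otimes>\<^sub>M borel)"
    and int: "integrable (lborel \<Otimes>\<^sub>M pX) (\<lambda>(q, x). phi \<mu> (q - x) * f (q, x))"
  shows "integrable (input_space pX \<mu>) (\<lambda>(x, v). f (x + v, x))"
    "(\<integral>(x, v). f (x + v, x) \<partial>input_space pX \<mu>)
      = (\<integral>q. \<integral>x. phi \<mu> (q - x) * f (q, x) \<partial>pX \<partial>lborel)"
proof -
  have "sets (lborel \<Otimes>\<^sub>M pX) = sets (borel \<Otimes>\<^sub>M borel)"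
    by (intro sets_pair_measure_cong) simp_all
  from measurable_cong_sets[OF this, of borel borel]
  have meas [measurable]: "f \<in> borel_measurable (lborel \<Otimes>\<^sub>M pX)"
    using assms(1) by simp
  have "integrable (density (lborel \<Otimes>\<^sub>M pX) (\<lambda>w. ennreal (phi \<mu> (fst w - snd w)))) f"
    using int by (subst integrable_density) (auto simp: case_prod_beta')
  then have "integrable (distr (input_space pX \<mu>) (borel \<Otimes>\<^sub>M borel) (\<lambda>(x, v). (x + v, x))) f"
    unfolding distr_input_space by (simp add: case_prod_beta')
  then show "integrable (input_space pX \<mu>) (\<lambda>(x, v). f (x + v, x))"
    by (subst (asm) integrable_distr_eq) (auto simp: case_prod_beta')
  have "(\<integral>(x, v). f (x + v, x) \<partial>input_space pX \<mu>)
     = (\<integral>w. f w \<partial>distr (input_space pX \<mu>) (borel \<Otimes>\<^sub>M borel) (\<lambda>(x, v). (x + v, x)))"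
    by (subst integral_distr) (auto simp: case_prod_beta')
  also have "\<dots> = (\<integral>(q, x). phi \<mu> (q - x) * f (q, x) \<partial>(lborel \<Otimes>\<^sub>M pX))"
    unfolding distr_input_space by (simp add: case_prod_beta' integral_density)
  also have "\<dots> = (\<integral>q. \<integral>x. phi \<mu> (q - x) * f (q, x) \<partial>pX \<partial>lborel)"
    using pair.integral_fst'[OF int] by simp
  finally show "(\<integral>(x, v). f (x + v, x) \<partial>input_space pX \<mu>) = \<dots>" .
qed

end

end

section \<open>The posterior mean as conditional expectation and its mean square error\<close>

context square_integrable_law
begin

context
  fixes \<mu> :: real
  assumes mu_pos: "0 < \<mu>"
begin

interpretation input: prob_space "input_space pX \<mu>"
  using mu_pos by (rule prob_space_input_space)

lemma integrable_posterior_square_error: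
  "integrable (lborel \<Otimes>\<^sub>M pX) (\<lambda>(q, x). phi \<mu> (q - x) * (x - posterior_mean pX \<mu> q)\<^sup>2)"
  "integrable lborel (\<lambda>q. (posterior_moment pX 1 \<mu> q)\<^sup>2 / posterior_moment pX 0 \<mu> q)"
proof -
  show int: "integrable lborel (\<lambda>q. (posterior_moment pX 1 \<mu> q)\<^sup>2 / posterior_moment pX 0 \<mu> q)"
    using posterior_moment_square_le[OF mu_pos] posterior_moment_0_pos[OF mu_pos]
    by (intro Bochner_Integration.integrable_bound[OF posterior_moment_integral(1)[OF mu_pos, of 2]])
      (auto intro!: AE_I2 order.trans[OF _ abs_ge_self] simp: less_imp_le)
  show "integrable (lborel \<Otimes>\<^sub>M pX) (\<lambda>(q, x). phi \<mu> (q - x) * (x - posterior_mean pX \<mu> q)\<^sup>2)"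
    using posterior_square_error[OF mu_pos] int posterior_moment_integral(1)[OF mu_pos, of 2]
    by (intro pair.Fubini_integrable) (auto simp: mult.commute)
qed

text \<open>The posterior mean is \<open>x\<close> minus the error, and the error is integrable
  because its modulus is at most 1 plus its square.\<close>

lemma integrable_posterior_mean:
  "integrable (lborel \<Otimes>\<^sub>M pX) (\<lambda>(q, x). phi \<mu> (q - x) * posterior_mean pX \<mu> q)"
proof -
  have x: "integrable (lborel \<Otimes>\<^sub>M pX) (\<lambda>(q, x). x * phi \<mu> (q - x))"
    using integrable_power_phi[OF mu_pos, of 1] by simp
  have one: "integrable (lborel \<Otimes>\<^sub>M pX) (\<lambda>(q, x). phi \<mu> (q - x))"
    using integrable_power_phi[OF mu_pos, of 0] by simp
  have le: "phi \<mu> y * \<bar>t\<bar> \<le> phi \<mu> y + phi \<mu> y * t\<^sup>2" for t y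
    using mult_left_mono[OF abs_power_le_one_plus_square[of 1 t], of "phi \<mu> y"]
    by (simp add: distrib_left)
  have "integrable (lborel \<Otimes>\<^sub>M pX) (\<lambda>(q, x). phi \<mu> (q - x) * (x - posterior_mean pX \<mu> q))"
    by (rule Bochner_Integration.integrable_bound[OF
          Bochner_Integration.integrable_add[OF one integrable_posterior_square_error(1)]])
      (auto simp: abs_mult intro!: AE_I2 le)
  from Bochner_Integration.integrable_diff[OF x this] show ?thesis
    by (simp add: case_prod_beta' algebra_simps)
qed

text \<open>The events of \<open>F\<close> have the form \<open>q \<in> B\<close>. Integrating over
  \<open>x\<close> at fixed \<open>q\<close>, the integrand \<open>x\<close> gives the first
  posterior moment and the posterior mean gives itself times the moment of order 0; these agree by
  the definition of the quotient.\<close>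

lemma cond_exp_input_eq_posterior_mean:
  defines "F \<equiv> vimage_algebra (space (input_space pX \<mu>)) (\<lambda>(x, v). x + v) borel"
  shows "sigma_finite_subalgebra (input_space pX \<mu>) F"
    "AE \<omega> in input_space pX \<mu>.
      real_cond_exp (input_space pX \<mu>) F fst \<omega> = posterior_mean pX \<mu> (fst \<omega> + snd \<omega>)"
proof -
  have space: "space (input_space pX \<mu>) = UNIV"
    using sets_eq_imp_space_eq[OF sets_input_space[OF mu_pos]] by (simp add: space_pair_measure)
  note [measurable_cong] = sets_input_space[OF mu_pos]
  have "subalgebra (input_space pX \<mu>) F"
    unfolding subalgebra_def F_def
    by (auto simp: sets_vimage_algebra2 intro!: measurable_sets)
  then interpret finite_measure_subalgebra "input_space pX \<mu>" F
    by unfold_locales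
  show "sigma_finite_subalgebra (input_space pX \<mu>) F" ..
  have int1: "integrable (input_space pX \<mu>) fst"
    using integral_input_space(1)[OF mu_pos, of snd] integrable_power_phi[OF mu_pos, of 1]
    by (simp add: case_prod_beta' mult.commute)
  have int2: "integrable (input_space pX \<mu>) (\<lambda>\<omega>. posterior_mean pX \<mu> (fst \<omega> + snd \<omega>))"
    using integral_input_space(1)[OF mu_pos, of "\<lambda>\<omega>. posterior_mean pX \<mu> (fst \<omega>)"]
      integrable_posterior_mean
    by (simp add: case_prod_beta')
  have meas: "(\<lambda>\<omega>. posterior_mean pX \<mu> (fst \<omega> + snd \<omega>)) \<in> borel_measurable F"
  proof -
    have "(\<lambda>(x, v). x + v) \<in> measurable F borel"
      unfolding F_def space by (rule measurable_vimage_algebra1) auto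
    from measurable_compose[OF this posterior_mean_measurable] show ?thesis
      by (simp add: case_prod_beta')
  qed
  have "(\<integral>\<omega>\<in>A. fst \<omega> \<partial>input_space pX \<mu>)
    = (\<integral>\<omega>\<in>A. posterior_mean pX \<mu> (fst \<omega> + snd \<omega>) \<partial>input_space pX \<mu>)" if "A \<in> sets F" for A
  proof -
    from that obtain B where B [measurable]: "B \<in> sets borel" and A: "A = (\<lambda>(x, v). x + v) -` B"
      unfolding F_def space by (auto simp: sets_vimage_algebra2)
    have ind: "indicator A \<omega> = (indicator B (fst \<omega> + snd \<omega>) :: real)" for \<omega>
      by (auto simp: A indicator_def case_prod_beta')
    have "(\<integral>\<omega>\<in>A. fst \<omega> \<partial>input_space pX \<mu>)
       = (\<integral>(x, v). (\<lambda>(q, x). indicator B q * x) (x + v, x) \<partial>input_space pX \<mu>)"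
      by (simp add: set_lebesgue_integral_def ind case_prod_beta')
    also have "\<dots> = (\<integral>q. \<integral>x. phi \<mu> (q - x) * (indicator B q * x) \<partial>pX \<partial>lborel)"
    proof (subst integral_input_space(2)[OF mu_pos])
      show "integrable (lborel \<Otimes>\<^sub>M pX) (\<lambda>(q, x). phi \<mu> (q - x) * (case (q, x) of (q, x) \<Rightarrow> indicat_real B q * x))"
        by (rule Bochner_Integration.integrable_bound[OF integrable_power_phi[OF mu_pos, of 1]])
          (auto simp: case_prod_beta' indicator_def mult.commute intro!: AE_I2)
    qed simp_all
    also have "\<dots> = (\<integral>q. indicator B q * posterior_moment pX 1 \<mu> q \<partial>lborel)"
      by (simp add: posterior_moment_def mult.assoc mult.left_commute[of "phi _ _" "indicator _ _"])
        (simp add: mult.commute)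
    also have "\<dots> = (\<integral>q. \<integral>x. phi \<mu> (q - x) * (indicator B q * posterior_mean pX \<mu> q) \<partial>pX \<partial>lborel)"
    proof (rule Bochner_Integration.integral_cong[OF refl])
      fix q
      have "(\<integral>x. phi \<mu> (q - x) * (indicator B q * posterior_mean pX \<mu> q) \<partial>pX)
        = posterior_moment pX 0 \<mu> q * (indicator B q * posterior_mean pX \<mu> q)"
        by (simp add: posterior_moment_def)
      then show "indicator B q * posterior_moment pX 1 \<mu> q
         = (\<integral>x. phi \<mu> (q - x) * (indicator B q * posterior_mean pX \<mu> q) \<partial>pX)"
        using posterior_moment_0_pos[OF mu_pos, of q] by (simp add: posterior_mean_def)
    qed
    also have "\<dots> = (\<integral>(x, v). (\<lambda>(q, x). indicator B q * posterior_mean pX \<mu> q) (x + v, x) \<partial>input_space pX \<mu>)"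
    proof (subst integral_input_space(2)[OF mu_pos])
      show "integrable (lborel \<Otimes>\<^sub>M pX) (\<lambda>(q, x). phi \<mu> (q - x) * (case (q, x) of (q, x) \<Rightarrow> indicat_real B q * posterior_mean pX \<mu> q))"
        using integrable_posterior_mean
        by (elim Bochner_Integration.integrable_bound)
          (auto simp: case_prod_beta' indicator_def intro!: AE_I2)
    qed simp_all
    also have "\<dots> = (\<integral>\<omega>\<in>A. posterior_mean pX \<mu> (fst \<omega> + snd \<omega>) \<partial>input_space pX \<mu>)"
      by (simp add: set_lebesgue_integral_def ind case_prod_beta')
    finally show ?thesis .
  qed
  from real_cond_exp_charact[OF this int1 int2 meas]
  show "AE \<omega> in input_space pX \<mu>.
      real_cond_exp (input_space pX \<mu>) F fst \<omega> = posterior_mean pX \<mu> (fst \<omega> + snd \<omega>)" .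
qed

text \<open>Conditional expectations are fixed only up to null sets, but the outer one disappears on
  integration and the inner one may be replaced by the posterior mean. In the third form the
  variance enters through a single integral over \<open>q\<close>, which is suited to the proof of
  continuity.\<close>

lemma mmse_eq_square_error:
  "integrable (input_space pX \<mu>) (\<lambda>(x, v). (x - posterior_mean pX \<mu> (x + v))\<^sup>2)"
  "mmse pX \<mu> = (\<integral>(x, v). (x - posterior_mean pX \<mu> (x + v))\<^sup>2 \<partial>input_space pX \<mu>)"
  "mmse pX \<mu> = (\<integral>x. x\<^sup>2 \<partial>pX)
    - (\<integral>q. (posterior_moment pX 1 \<mu> q)\<^sup>2 / posterior_moment pX 0 \<mu> q \<partial>lborel)"
proof -
  note [measurable_cong] = sets_input_space[OF mu_pos]
  define F where "F = vimage_algebra (space (input_space pX \<mu>)) (\<lambda>(x, v). x + v) borel"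
  interpret sigma_finite_subalgebra "input_space pX \<mu>" F
    unfolding F_def by (rule cond_exp_input_eq_posterior_mean)
  note int = integral_input_space[OF mu_pos, of "\<lambda>(q, x). (x - posterior_mean pX \<mu> q)\<^sup>2"]
  have meas: "(\<lambda>(q, x). (x - posterior_mean pX \<mu> q)\<^sup>2) \<in> borel_measurable (borel \<Otimes>\<^sub>M borel)"
    by measurable
  show sq: "integrable (input_space pX \<mu>) (\<lambda>(x, v). (x - posterior_mean pX \<mu> (x + v))\<^sup>2)"
    using int(1)[OF meas] integrable_posterior_square_error(1) by simp
  have "AE \<omega> in input_space pX \<mu>. (fst \<omega> - real_cond_exp (input_space pX \<mu>) F fst \<omega>)\<^sup>2
     = (case \<omega> of (x, v) \<Rightarrow> (x - posterior_mean pX \<mu> (x + v))\<^sup>2)"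
    using cond_exp_input_eq_posterior_mean(2) by (auto simp: F_def case_prod_beta' elim: AE_mp)
  then have "integrable (input_space pX \<mu>) (\<lambda>\<omega>. (fst \<omega> - real_cond_exp (input_space pX \<mu>) F fst \<omega>)\<^sup>2)"
    "(\<integral>\<omega>. (fst \<omega> - real_cond_exp (input_space pX \<mu>) F fst \<omega>)\<^sup>2 \<partial>input_space pX \<mu>)
     = (\<integral>(x, v). (x - posterior_mean pX \<mu> (x + v))\<^sup>2 \<partial>input_space pX \<mu>)"
    using sq by (auto intro!: integral_cong_AE integrable_cong_AE_imp[OF sq] simp: case_prod_beta' AE_symmetric)
  then show eq: "mmse pX \<mu> = (\<integral>(x, v). (x - posterior_mean pX \<mu> (x + v))\<^sup>2 \<partial>input_space pX \<mu>)"
    using real_cond_exp_int(2)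
    by (simp add: mmse_def E_in_def cond_variance_def F_def)
  also have "\<dots> = (\<integral>q. posterior_moment pX 2 \<mu> q
       - (posterior_moment pX 1 \<mu> q)\<^sup>2 / posterior_moment pX 0 \<mu> q \<partial>lborel)"
    using int(2)[OF meas] integrable_posterior_square_error(1)
    by (simp add: mult.commute[of "phi _ _"] posterior_square_error[OF mu_pos])
  finally show "mmse pX \<mu> = (\<integral>x. x\<^sup>2 \<partial>pX)
    - (\<integral>q. (posterior_moment pX 1 \<mu> q)\<^sup>2 / posterior_moment pX 0 \<mu> q \<partial>lborel)"
    using posterior_moment_integral[OF mu_pos, of 2] integrable_posterior_square_error(2) by simp
qed

lemma mmse_nonneg: "0 \<le> mmse pX \<mu>"
  unfolding mmse_eq_square_error(2) by (auto intro!: integral_nonneg_AE)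

lemma ennreal_mmse:
  "ennreal (mmse pX \<mu>) = (\<integral>\<^sup>+(x, v). ennreal ((x - posterior_mean pX \<mu> (x + v))\<^sup>2) \<partial>input_space pX \<mu>)"
  unfolding mmse_eq_square_error(2)
  using mmse_eq_square_error(1) by (subst nn_integral_eq_integral[symmetric]) (auto simp: case_prod_beta')

text \<open>Holds pointwise in \<open>q\<close>: by \<open>posterior_square_error\<close> an
  estimate \<open>h q\<close> exceeds the optimum by a nonnegative term. With values in
  \<open>ennreal\<close> the estimator may have infinite error, so no integrability of
  \<open>h\<close> has to be carried along.\<close>

lemma mmse_le_square_error:
  assumes [measurable]: "h \<in> borel_measurable borel"
  shows "ennreal (mmse pX \<mu>) \<le> (\<integral>\<^sup>+(x, v). ennreal ((x - h (x + v))\<^sup>2) \<partial>input_space pX \<mu>)"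
proof -
  have err: "(\<integral>\<^sup>+(x, v). ennreal ((x - h (x + v))\<^sup>2) \<partial>input_space pX \<mu>)
     = (\<integral>\<^sup>+q. ennreal (\<integral>x. (x - h q)\<^sup>2 * phi \<mu> (q - x) \<partial>pX) \<partial>lborel)"
    if [measurable]: "h \<in> borel_measurable borel" for h
    using nn_integral_input_space[OF mu_pos, of "\<lambda>(q, x). ennreal ((x - h q)\<^sup>2)"]
      posterior_square_error(1)[OF mu_pos]
    by (simp add: nn_integral_eq_integral ennreal_mult'[symmetric] mult.commute)
  show ?thesis
    unfolding ennreal_mmse err[OF assms] err[OF posterior_mean_measurable]
      posterior_square_error[OF mu_pos]
    using posterior_moment_0_pos[OF mu_pos]
    by (intro nn_integral_mono ennreal_leI) (auto simp: less_imp_le)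
qed

lemma mmse_le_variance: "mmse pX \<mu> \<le> mu_x_init pX"
proof -
  define c where "c = (\<integral>x. x \<partial>pX)"
  interpret g: prob_space "gaussian \<mu>" using mu_pos by simp
  have int: "integrable pX (\<lambda>x. (x - c)\<^sup>2)"
    using integrable_power[of 1] square_integrable by (simp add: power2_diff)
  have "ennreal (mmse pX \<mu>) \<le> (\<integral>\<^sup>+(x, v). ennreal ((x - c)\<^sup>2) \<partial>input_space pX \<mu>)"
    by (rule mmse_le_square_error) simp
  also have "\<dots> = (\<integral>\<^sup>+x. ennreal ((x - c)\<^sup>2) \<partial>pX)"
    unfolding input_space_def by (subst g.nn_integral_fst[symmetric]) (auto simp: g.emeasure_space_1[simplified])
  also have "\<dots> = ennreal (mu_x_init pX)"
    using int by (simp add: nn_integral_eq_integral mu_x_init_def c_def)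
  finally show ?thesis
    by (subst (asm) ennreal_le_iff) (auto simp: mu_x_init_def)
qed

end

section \<open>Dependence of the mean square error on the noise variance\<close>

lemma mmse_mono:
  assumes "0 < a" "a \<le> b"
  shows "mmse pX a \<le> mmse pX b"
proof -
  interpret ga: prob_space "gaussian a" using assms by simp
  interpret gb: prob_space "gaussian b" using assms by simp
  interpret gd: prob_space "gaussian (b - a)" using assms by simp
  interpret p: pair_sigma_finite "gaussian (b - a)" pX ..
  define h where "h = posterior_mean pX b"
  have [measurable]: "h \<in> borel_measurable borel" by (simp add: h_def)
  have "ennreal (mmse pX a) = (\<integral>\<^sup>+w. ennreal (mmse pX a) \<partial>gaussian (b - a))"
    by (simp add: gd.emeasure_space_1[simplified])
  also have "\<dots> \<le> (\<integral>\<^sup>+w. \<integral>\<^sup>+(x, v). ennreal ((x - h (x + v + w))\<^sup>2) \<partial>input_space pX a \<partial>gaussian (b - a))"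
    using assms by (intro nn_integral_mono mmse_le_square_error[of a "\<lambda>q. h (q + w)" for w]) auto
  also have "\<dots> = (\<integral>\<^sup>+w. \<integral>\<^sup>+x. \<integral>\<^sup>+v. ennreal ((x - h (x + v + w))\<^sup>2) \<partial>gaussian a \<partial>pX \<partial>gaussian (b - a))"
    unfolding input_space_def by (subst ga.nn_integral_fst[symmetric]) auto
  also have "\<dots> = (\<integral>\<^sup>+x. \<integral>\<^sup>+w. \<integral>\<^sup>+v. ennreal ((x - h (x + (w + v)))\<^sup>2) \<partial>gaussian a \<partial>gaussian (b - a) \<partial>pX)"
    by (subst p.Fubini') (auto simp: ac_simps)
  also have "\<dots> = (\<integral>\<^sup>+x. \<integral>\<^sup>+v. ennreal ((x - h (x + v))\<^sup>2) \<partial>gaussian b \<partial>pX)"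
    using assms
    by (subst nn_integral_gaussian_add[of "b - a" a "\<lambda>v. ennreal ((x - h (x + v))\<^sup>2)" for x]) auto
  also have "\<dots> = ennreal (mmse pX b)"
    using assms unfolding ennreal_mmse[of b, OF less_le_trans[OF assms]] h_def[symmetric] input_space_def
    by (subst gb.nn_integral_fst[symmetric]) auto
  finally show ?thesis
    using mmse_nonneg[of b] assms by (subst (asm) ennreal_le_iff) auto
qed

lemma posterior_moment_continuous_on:
  assumes "0 < a" "k \<le> 2"
  shows "continuous_on {a..b} (\<lambda>\<mu>. posterior_moment pX k \<mu> q)"
  unfolding posterior_moment_def
proof (rule continuous_on_sequentiallyI)
  fix u l assume u: "\<forall>n. u n \<in> {a..b}" and l: "l \<in> {a..b}" and lim: "u \<longlonglongrightarrow> l"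
  show "(\<lambda>n. \<integral>x. x ^ k * phi (u n) (q - x) \<partial>pX) \<longlonglongrightarrow> (\<integral>x. x ^ k * phi l (q - x) \<partial>pX)"
  proof (rule integral_dominated_convergence[where w = "\<lambda>x. sqrt (b / a) * \<bar>x ^ k * phi b (q - x)\<bar>"])
    show "integrable pX (\<lambda>x. sqrt (b / a) * \<bar>x ^ k * phi b (q - x)\<bar>)"
      using integrable_posterior_moment[of b k q] assms l by auto
    have "(\<lambda>n. phi (u n) (q - x)) \<longlonglongrightarrow> phi l (q - x)" for x
    proof (rule Lim_transform_eventually)
      show "(\<lambda>n. exp (- (q - x)\<^sup>2 / (2 * u n)) / sqrt (2 * pi * u n)) \<longlonglongrightarrow> phi l (q - x)"
        using lim assms l by (auto simp: phi_eq intro!: tendsto_intros)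
      show "\<forall>\<^sub>F n in sequentially. exp (- (q - x)\<^sup>2 / (2 * u n)) / sqrt (2 * pi * u n) = phi (u n) (q - x)"
        using assms u by (intro always_eventually) (auto simp: phi_eq less_le_trans)
    qed
    then show "AE x in pX. (\<lambda>n. x ^ k * phi (u n) (q - x)) \<longlonglongrightarrow> x ^ k * phi l (q - x)"
      by (auto intro!: tendsto_intros)
    show "AE x in pX. norm (x ^ k * phi (u n) (q - x)) \<le> sqrt (b / a) * \<bar>x ^ k * phi b (q - x)\<bar>" for n
      using phi_mono_variance[OF \<open>0 < a\<close>, of "u n" b] u
      by (auto simp: abs_mult mult.left_commute[of "sqrt _"] intro!: AE_I2 mult_left_mono)
  qed measurable
qed

text \<open>This gives the convergence of \<open>\<mu>x t s\<close> for each fixed \<open>s\<close>.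
  The integrand over \<open>q\<close> is bounded by the second posterior moment (Cauchy-Schwarz),
  and that in turn, for all variances in \<open>[a, b]\<close>, by \<open>sqrt (b / a)\<close> times
  its value at \<open>b\<close>.\<close>

lemma mmse_continuous_on:
  assumes "0 < a"
  shows "continuous_on {a..b} (mmse pX)"
proof -
  have "continuous_on {a..b} (\<lambda>\<mu>. \<integral>q. (posterior_moment pX 1 \<mu> q)\<^sup>2 / posterior_moment pX 0 \<mu> q \<partial>lborel)"
  proof (rule continuous_on_sequentiallyI)
    fix u l assume u: "\<forall>n. u n \<in> {a..b}" and l: "l \<in> {a..b}" and lim: "u \<longlonglongrightarrow> l"
    have pos: "0 < u n" "0 < l" "0 < b" for n using u l assms by (auto intro: less_le_trans)
    show "(\<lambda>n. \<integral>q. (posterior_moment pX 1 (u n) q)\<^sup>2 / posterior_moment pX 0 (u n) q \<partial>lborel)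
      \<longlonglongrightarrow> (\<integral>q. (posterior_moment pX 1 l q)\<^sup>2 / posterior_moment pX 0 l q \<partial>lborel)"
    proof (rule integral_dominated_convergence[where w = "\<lambda>q. sqrt (b / a) * posterior_moment pX 2 b q"])
      show "integrable lborel (\<lambda>q. sqrt (b / a) * posterior_moment pX 2 b q)"
        using posterior_moment_integral(1)[of b 2] pos by auto
      have "(\<lambda>n. posterior_moment pX k (u n) q) \<longlonglongrightarrow> posterior_moment pX k l q" if "k \<le> 2" for k q
        using posterior_moment_continuous_on[OF assms that, of b q] u l lim
        by (auto simp: continuous_on_sequentially o_def)
      then show "AE q in lborel. (\<lambda>n. (posterior_moment pX 1 (u n) q)\<^sup>2 / posterior_moment pX 0 (u n) q)
        \<longlonglongrightarrow> (posterior_moment pX 1 l q)\<^sup>2 / posterior_moment pX 0 l q"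
        using posterior_moment_0_pos[OF pos(2)] by (auto intro!: tendsto_intros simp: less_imp_neq[symmetric])
      show "AE q in lborel. norm ((posterior_moment pX 1 (u n) q)\<^sup>2 / posterior_moment pX 0 (u n) q)
         \<le> sqrt (b / a) * posterior_moment pX 2 b q" for n
      proof (rule AE_I2)
        fix q
        have "norm ((posterior_moment pX 1 (u n) q)\<^sup>2 / posterior_moment pX 0 (u n) q)
           \<le> posterior_moment pX 2 (u n) q"
          using posterior_moment_square_le[OF pos(1)[of n], of q] posterior_moment_0_pos[OF pos(1)[of n], of q] by simp
        also have "\<dots> \<le> (\<integral>x. sqrt (b / a) * (x\<^sup>2 * phi b (q - x)) \<partial>pX)"
          unfolding posterior_moment_def
          using integrable_posterior_moment[of _ 2 q] pos u
            mult_left_mono[OF phi_mono_variance[OF \<open>0 < a\<close>, of "u n" b], of "x\<^sup>2" for x]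
          by (intro integral_mono) (auto simp: mult.left_commute)
        finally show "norm ((posterior_moment pX 1 (u n) q)\<^sup>2 / posterior_moment pX 0 (u n) q)
         \<le> sqrt (b / a) * posterior_moment pX 2 b q"
          by (simp add: posterior_moment_def)
      qed
    qed measurable
  qed
  then have "continuous_on {a..b} (\<lambda>\<mu>. (\<integral>x. x\<^sup>2 \<partial>pX)
     - (\<integral>q. (posterior_moment pX 1 \<mu> q)\<^sup>2 / posterior_moment pX 0 \<mu> q \<partial>lborel))"
    by (intro continuous_intros)
  then show ?thesis
    using assms by (subst continuous_on_cong[OF refl mmse_eq_square_error(3)]) auto
qed

section \<open>Averaging over the scale \<open>s\<close>\<close>

lemma mmse_scaled_integrable:
  assumes "real_distribution pS" "AE s in pS. 0 < s" "integrable pS (\<lambda>s. s)" "0 < \<mu>"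
  shows "integrable pS (\<lambda>s. s * mmse pX (\<mu> / s))"
proof -
  interpret S: real_distribution pS by fact
  \<comment> \<open>Cut off to 0 on the left, the error is monotone on the whole line and hence
    Borel. Evenness in the variance covers \<open>s < 0\<close>, and at \<open>s = 0\<close> the
    factor \<open>s\<close> removes the value of \<open>mmse\<close>.\<close>
  define k where "k t = (if 0 < t then mmse pX t else 0)" for t
  have "mono k"
    unfolding k_def by (auto simp: mono_def intro: mmse_mono mmse_nonneg)
  then have [measurable]: "k \<in> borel_measurable borel"
    by (rule borel_measurable_mono)
  have eq: "s * mmse pX (\<mu> / s) = s * k \<bar>\<mu> / s\<bar>" for s
    using \<open>0 < \<mu>\<close> mmse_abs[of pX "\<mu> / s"] by (cases "s = 0") (auto simp: k_def)
  have [measurable]: "(\<lambda>s. s * mmse pX (\<mu> / s)) \<in> borel_measurable borel"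
    unfolding eq by measurable
  have "integrable pS (\<lambda>s. s * mu_x_init pX)" using assms(3) by simp
  then show ?thesis
  proof (rule Bochner_Integration.integrable_bound)
    show "AE s in pS. norm (s * mmse pX (\<mu> / s)) \<le> norm (s * mu_x_init pX)"
      using assms(2)
    proof eventually_elim
      case (elim s)
      then have "0 < \<mu> / s" using \<open>0 < \<mu>\<close> by simp
      from mmse_nonneg[OF this] mmse_le_variance[OF this] elim show ?case
        by (simp add: abs_mult)
    qed
  qed simp
qed

lemma Ebar_in_bounds:
  assumes "real_distribution pS" "AE s in pS. 0 < s" "integrable pS (\<lambda>s. s)" "0 < \<mu>"
  shows "0 \<le> Ebar_in pX pS \<mu>" "Ebar_in pX pS \<mu> \<le> (\<integral>s. s \<partial>pS) * mu_x_init pX"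
proof -
  have AE: "AE s in pS. 0 \<le> s * mmse pX (\<mu> / s) \<and> s * mmse pX (\<mu> / s) \<le> s * mu_x_init pX"
    using assms(2)
  proof eventually_elim
    case (elim s)
    then have "0 < \<mu> / s" using \<open>0 < \<mu>\<close> by simp
    from mmse_nonneg[OF this] mmse_le_variance[OF this] elim show ?case by simp
  qed
  then show "0 \<le> Ebar_in pX pS \<mu>"
    unfolding Ebar_in_eq_mmse by (intro integral_nonneg_AE) auto
  have "Ebar_in pX pS \<mu> \<le> (\<integral>s. s * mu_x_init pX \<partial>pS)"
    unfolding Ebar_in_eq_mmse using AE assms(3)
    by (intro integral_mono_AE mmse_scaled_integrable assms) auto
  then show "Ebar_in pX pS \<mu> \<le> (\<integral>s. s \<partial>pS) * mu_x_init pX" by simp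
qed

lemma Ebar_in_mono:
  assumes "real_distribution pS" "AE s in pS. 0 < s" "integrable pS (\<lambda>s. s)" "0 < a" "a \<le> b"
  shows "Ebar_in pX pS a \<le> Ebar_in pX pS b"
  unfolding Ebar_in_eq_mmse
proof (intro integral_mono_AE mmse_scaled_integrable assms)
  show "AE s in pS. s * mmse pX (a / s) \<le> s * mmse pX (b / s)"
    using assms(2)
  proof eventually_elim
    case (elim s)
    then show ?case
      using mmse_mono[of "a / s" "b / s"] assms by (simp add: divide_right_mono)
  qed
qed (use assms in auto)

end

section \<open>Output function\<close>

text \<open>The condition on a likelihood \<open>z \<mapsto> p y z\<close> at fixed
  \<open>y\<close>. It asks for all variances at once because bounds on moments trade a power of
  \<open>z\<close> for a larger variance.\<close>

definition gauss_integrable :: "(real \<Rightarrow> real) \<Rightarrow> bool" where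
  "gauss_integrable f \<longleftrightarrow> f \<in> borel_measurable borel \<and> (\<forall>z. 0 \<le> f z) \<and>
     (\<forall>\<mu>>0. \<forall>u. integrable lborel (\<lambda>z. f z * phi \<mu> (z - u)))"

text \<open>These moments stand for derivatives: differentiating the Gaussian in \<open>u\<close>
  brings down \<open>(z - u) / \<mu>\<close>. Writing \<open>A k\<close> for the moment of order
  \<open>k\<close>, the smoothed density is \<open>P = A 0\<close>, with
  \<open>P' = A 1 / \<mu>\<close> and \<open>P'' = A 2 / \<mu>^2 - A 0 / \<mu>\<close>.\<close>

definition smoothed_moment :: "(real \<Rightarrow> real) \<Rightarrow> nat \<Rightarrow> real \<Rightarrow> real \<Rightarrow> real" where
  "smoothed_moment f k \<mu> u = (\<integral>z. (z - u) ^ k * (f z * phi \<mu> (z - u)) \<partial>lborel)"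

lemma p_Y_Zhat_eq_smoothed_moment: "\<mu> \<noteq> 0 \<Longrightarrow> p_Y_Zhat p y u \<mu> = smoothed_moment (p y) 0 \<mu> u"
  by (simp add: p_Y_Zhat_def smoothed_moment_def phi_def)

text \<open>The exponential is the square of \<open>exp (- v^2 / (4 * \<mu>))\<close>. One factor
  absorbs the power at the cost of \<open>1 + 4 * \<mu>\<close>; the other is the Gaussian of
  variance \<open>2 * \<mu>\<close>, whose normalisation accounts for \<open>sqrt 2\<close>.\<close>

lemma power_mult_phi_le:
  assumes "0 < \<mu>" "k \<le> 2"
  shows "\<bar>v\<bar> ^ k * phi \<mu> v \<le> (1 + 4 * \<mu>) * sqrt 2 * phi (2 * \<mu>) v"
proof -
  define x where "x = v\<^sup>2 / (4 * \<mu>)"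
  have x: "0 \<le> x" "v\<^sup>2 = 4 * \<mu> * x" using assms by (auto simp: x_def)
  have "x \<le> exp x" using exp_ge_add_one_self[of x] by linarith
  then have "x * exp (- x) \<le> 1" by (simp add: exp_minus field_simps)
  moreover have "exp (- x) \<le> 1" using x by simp
  moreover have "4 * \<mu> * (x * exp (- x)) \<le> 4 * \<mu> * 1"
    using assms calculation by (intro mult_left_mono) auto
  ultimately have le: "(1 + v\<^sup>2) * exp (- x) \<le> 1 + 4 * \<mu>"
    by (simp only: x distrib_right)
  have phi: "phi \<mu> v = exp (- x) * (sqrt 2 * phi (2 * \<mu>) v)"
  proof -
    have "exp (- v\<^sup>2 / (2 * \<mu>)) = exp (- x) * exp (- v\<^sup>2 / (2 * (2 * \<mu>)))"
      using assms by (simp add: x_def exp_add[symmetric] field_simps)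
    moreover have "sqrt (2 * pi * (2 * \<mu>)) = sqrt 2 * sqrt (2 * pi * \<mu>)"
      by (simp only: real_sqrt_mult[symmetric]) (simp add: mult_ac)
    ultimately show ?thesis using assms by (simp add: phi_eq del: real_sqrt_mult)
  qed
  have "\<bar>v\<bar> ^ k * phi \<mu> v \<le> (1 + v\<^sup>2) * phi \<mu> v"
    using abs_power_le_one_plus_square[OF assms(2)] by (intro mult_right_mono) auto
  also have "\<dots> = ((1 + v\<^sup>2) * exp (- x)) * (sqrt 2 * phi (2 * \<mu>) v)"
    by (simp add: phi)
  also have "\<dots> \<le> (1 + 4 * \<mu>) * (sqrt 2 * phi (2 * \<mu>) v)"
    using le by (intro mult_right_mono) auto
  finally show ?thesis by simp
qed

text \<open>Translating a Gaussian is an exponential tilt. So smoothing at \<open>u\<close> is a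
  Laplace transform at \<open>u / \<mu>\<close>.\<close>

lemma phi_shift:
  assumes "0 < \<mu>"
  shows "phi \<mu> (z - u) = exp (- u\<^sup>2 / (2 * \<mu>)) * exp (u / \<mu> * z) * phi \<mu> z"
proof -
  have "- (z - u)\<^sup>2 / (2 * \<mu>) = - u\<^sup>2 / (2 * \<mu>) + u / \<mu> * z + - z\<^sup>2 / (2 * \<mu>)"
    using assms by (simp add: field_simps power2_eq_square)
  then have "exp (- (z - u)\<^sup>2 / (2 * \<mu>)) = exp (- u\<^sup>2 / (2 * \<mu>)) * exp (u / \<mu> * z) * exp (- z\<^sup>2 / (2 * \<mu>))"
    by (simp only: exp_add)
  then show ?thesis unfolding phi_eq[OF assms] by simp
qed

text \<open>A single centred Gaussian with at least twice the variance dominates every translate.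
  Integer values of \<open>N\<close> thus control all pairs \<open>(\<mu>, u)\<close>, which reduces
  an uncountable family of conditions to a countable one.\<close>

lemma phi_shift_le:
  assumes "0 < \<mu>" "2 * \<mu> \<le> N"
  shows "phi \<mu> (z - u) \<le> exp (u\<^sup>2 / N) * sqrt (N / \<mu>) * phi N z"
proof -
  have N: "0 < N" using assms by simp
  have "0 \<le> (z - 2 * u)\<^sup>2" by simp
  then have "z\<^sup>2 \<le> 2 * (z - u)\<^sup>2 + 2 * u\<^sup>2" by (simp add: power2_eq_square algebra_simps)
  then have "z\<^sup>2 / (2 * N) \<le> (z - u)\<^sup>2 / N + u\<^sup>2 / N"
    using N by (simp add: field_simps)
  also have "(z - u)\<^sup>2 / N \<le> (z - u)\<^sup>2 / (2 * \<mu>)"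
    using assms N by (intro divide_left_mono) auto
  finally have "- (z - u)\<^sup>2 / (2 * \<mu>) \<le> u\<^sup>2 / N + - z\<^sup>2 / (2 * N)" by simp
  then have "exp (- (z - u)\<^sup>2 / (2 * \<mu>)) \<le> exp (u\<^sup>2 / N) * exp (- z\<^sup>2 / (2 * N))"
    by (simp only: exp_add[symmetric] exp_le_cancel_iff)
  then have "phi \<mu> (z - u) \<le> exp (u\<^sup>2 / N) * exp (- z\<^sup>2 / (2 * N)) / sqrt (2 * pi * \<mu>)"
    using assms by (simp add: phi_eq divide_right_mono)
  also have "\<dots> = exp (u\<^sup>2 / N) * sqrt (N / \<mu>) * phi N z"
    using assms N by (simp add: phi_eq real_sqrt_mult real_sqrt_divide)
  finally show ?thesis .
qed

section \<open>Differentiation of Laplace transforms\<close>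

lemma abs_exp_minus_one_le: "\<bar>exp x - 1\<bar> \<le> \<bar>x\<bar> * exp \<bar>x :: real\<bar>"
proof (cases "0 \<le> x")
  case True
  have "1 - x \<le> exp (- x)" using exp_ge_add_one_self[of "- x"] by simp
  then have "(1 - x) * exp x \<le> exp (- x) * exp x" by (intro mult_right_mono) auto
  then show ?thesis using True by (simp add: exp_minus algebra_simps)
next
  case False
  have "1 + x \<le> exp x" by simp
  moreover have "- x * 1 \<le> - x * exp (- x)" using False by (intro mult_left_mono) auto
  ultimately have "1 - exp x \<le> - x * exp (- x)" by linarith
  then show ?thesis using False by (simp add: abs_if)
qed

lemma abs_le_exp_plus_exp: "\<bar>x :: real\<bar> \<le> exp x + exp (- x)"
proof -
  have "1 + x \<le> exp x" "1 + - x \<le> exp (- x)" "0 < exp x" "0 < exp (- x)" 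
    using exp_ge_add_one_self[of x] exp_ge_add_one_self[of "- x"] by auto
  then show ?thesis by linarith
qed

context
  fixes \<kappa> :: "real \<Rightarrow> real"
  assumes integrable_exp: "\<And>a. integrable lborel (\<lambda>z. exp (a * z) * \<kappa> z)"
begin

lemma exponentially_integrable_measurable: "\<kappa> \<in> borel_measurable borel"
  using borel_measurable_integrable[OF integrable_exp[of 0]] by simp

text \<open>A factor \<open>z\<close> costs only a shift of \<open>a\<close> by 1 in both
  directions. Hence \<open>z * \<kappa> z\<close> satisfies the same hypothesis as
  \<open>\<kappa>\<close>, and the differentiation below can be iterated.\<close>

lemma integrable_exp_mult_ident: "integrable lborel (\<lambda>z. exp (a * z) * (z * \<kappa> z))"
proof (rule Bochner_Integration.integrable_bound)
  note [measurable] = exponentially_integrable_measurable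
  show "integrable lborel (\<lambda>z. \<bar>exp ((a + 1) * z) * \<kappa> z\<bar> + \<bar>exp ((a - 1) * z) * \<kappa> z\<bar>)"
    using integrable_exp by (intro Bochner_Integration.integrable_add integrable_abs)
  have "\<bar>exp (a * z) * (z * \<kappa> z)\<bar> \<le> \<bar>exp ((a + 1) * z) * \<kappa> z\<bar> + \<bar>exp ((a - 1) * z) * \<kappa> z\<bar>" for z
  proof -
    have "\<bar>exp (a * z) * (z * \<kappa> z)\<bar> = \<bar>z\<bar> * (exp (a * z) * \<bar>\<kappa> z\<bar>)"
      by (simp add: abs_mult)
    also have "\<dots> \<le> (exp z + exp (- z)) * (exp (a * z) * \<bar>\<kappa> z\<bar>)"
      by (intro mult_right_mono abs_le_exp_plus_exp) simp
    also have "\<dots> = \<bar>exp ((a + 1) * z) * \<kappa> z\<bar> + \<bar>exp ((a - 1) * z) * \<kappa> z\<bar>"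
      by (simp add: abs_mult distrib_right left_diff_distrib exp_add exp_diff exp_minus field_simps)
    finally show ?thesis .
  qed
  then show "AE z in lborel. norm (exp (a * z) * (z * \<kappa> z))
     \<le> norm (\<bar>exp ((a + 1) * z) * \<kappa> z\<bar> + \<bar>exp ((a - 1) * z) * \<kappa> z\<bar>)"
    by simp
  show "(\<lambda>z. exp (a * z) * (z * \<kappa> z)) \<in> borel_measurable lborel" by measurable
qed

text \<open>Along a null sequence of increments bounded by \<open>B\<close>, the difference quotient
  of the exponential is at most \<open>\<bar>z\<bar> * exp (B * \<bar>z\<bar>)\<close>. Bounding the
  last factor by a sum of two exponentials gives a majorant made of integrands at
  \<open>a + B\<close> and \<open>a - B\<close>.\<close>

lemma DERIV_integral_exp:
  "((\<lambda>a. \<integral>z. exp (a * z) * \<kappa> z \<partial>lborel) has_real_derivative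
     (\<integral>z. exp (a * z) * (z * \<kappa> z) \<partial>lborel)) (at a)"
  unfolding DERIV_def tendsto_at_iff_sequentially
proof (intro allI impI)
  note [measurable] = exponentially_integrable_measurable
  fix X :: "nat \<Rightarrow> real"
  assume X: "\<forall>i. X i \<in> UNIV - {0}" "X \<longlonglongrightarrow> 0"
  then have nz: "X i \<noteq> 0" for i by auto
  from X(2) have "Bseq X" using convergent_imp_Bseq convergentI by blast
  then obtain B where B: "0 < B" "\<And>i. \<bar>X i\<bar> \<le> B" by (auto simp: Bseq_def)
  have eq: "((\<integral>z. exp ((a + X i) * z) * \<kappa> z \<partial>lborel) - (\<integral>z. exp (a * z) * \<kappa> z \<partial>lborel)) / X i
     = (\<integral>z. exp (a * z) * \<kappa> z * ((exp (X i * z) - 1) / X i) \<partial>lborel)" for i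
  proof -
    have "exp (a * z) * \<kappa> z * ((exp (X i * z) - 1) / X i)
      = (exp ((a + X i) * z) * \<kappa> z - exp (a * z) * \<kappa> z) / X i" for z
      using nz[of i] by (simp add: distrib_right exp_add field_simps)
    then show ?thesis
      using integrable_exp[of "a + X i"] integrable_exp[of a]
      by (simp only: Bochner_Integration.integral_divide_zero Bochner_Integration.integral_diff)
  qed
  have "(\<lambda>i. \<integral>z. exp (a * z) * \<kappa> z * ((exp (X i * z) - 1) / X i) \<partial>lborel)
     \<longlonglongrightarrow> (\<integral>z. exp (a * z) * (z * \<kappa> z) \<partial>lborel)"
  proof (rule integral_dominated_convergence[where
        w = "\<lambda>z. \<bar>exp ((a + B) * z) * (z * \<kappa> z)\<bar> + \<bar>exp ((a - B) * z) * (z * \<kappa> z)\<bar>"])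
    show "integrable lborel (\<lambda>z. \<bar>exp ((a + B) * z) * (z * \<kappa> z)\<bar> + \<bar>exp ((a - B) * z) * (z * \<kappa> z)\<bar>)"
      by (intro Bochner_Integration.integrable_add integrable_abs integrable_exp_mult_ident)
    have "(\<lambda>i. (exp (X i * z) - 1) / X i) \<longlonglongrightarrow> z" for z
    proof -
      have "((\<lambda>h. exp (h * z)) has_real_derivative z) (at 0)"
        by (auto intro!: derivative_eq_intros)
      then show ?thesis
        using X nz by (auto simp: DERIV_def tendsto_at_iff_sequentially o_def)
    qed
    then have "(\<lambda>i. exp (a * z) * \<kappa> z * ((exp (X i * z) - 1) / X i)) \<longlonglongrightarrow> exp (a * z) * \<kappa> z * z" for z
      by (intro tendsto_mult_left)
    moreover have "exp (a * z) * \<kappa> z * z = exp (a * z) * (z * \<kappa> z)" for z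
      by simp
    ultimately show "AE z in lborel. (\<lambda>i. exp (a * z) * \<kappa> z * ((exp (X i * z) - 1) / X i))
       \<longlonglongrightarrow> exp (a * z) * (z * \<kappa> z)"
      by simp
    show "AE z in lborel. norm (exp (a * z) * \<kappa> z * ((exp (X i * z) - 1) / X i))
       \<le> \<bar>exp ((a + B) * z) * (z * \<kappa> z)\<bar> + \<bar>exp ((a - B) * z) * (z * \<kappa> z)\<bar>" for i
    proof (rule AE_I2)
      fix z
      have "\<bar>(exp (X i * z) - 1) / X i\<bar> \<le> \<bar>X i * z\<bar> * exp \<bar>X i * z\<bar> / \<bar>X i\<bar>"
        using abs_exp_minus_one_le[of "X i * z"] by (simp add: divide_right_mono)
      also have "\<dots> = \<bar>z\<bar> * exp \<bar>X i * z\<bar>"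
        using nz[of i] by (simp add: abs_mult)
      also have "exp \<bar>X i * z\<bar> \<le> exp (B * \<bar>z\<bar>)"
        using B(2)[of i] by (simp add: abs_mult mult_right_mono)
      also have "exp (B * \<bar>z\<bar>) \<le> exp (B * z) + exp (- (B * z))"
        by (auto simp: abs_if)
      finally have le: "\<bar>(exp (X i * z) - 1) / X i\<bar> \<le> \<bar>z\<bar> * (exp (B * z) + exp (- (B * z)))"
        by (simp add: mult_left_mono)
      have "norm (exp (a * z) * \<kappa> z * ((exp (X i * z) - 1) / X i))
        = exp (a * z) * \<bar>\<kappa> z\<bar> * \<bar>(exp (X i * z) - 1) / X i\<bar>"
        by (simp add: abs_mult)
      also have "\<dots> \<le> exp (a * z) * \<bar>\<kappa> z\<bar> * (\<bar>z\<bar> * (exp (B * z) + exp (- (B * z))))"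
        by (intro mult_left_mono le) simp
      also have "\<dots> = \<bar>exp ((a + B) * z) * (z * \<kappa> z)\<bar> + \<bar>exp ((a - B) * z) * (z * \<kappa> z)\<bar>"
        by (simp add: abs_mult distrib_right left_diff_distrib exp_add exp_diff exp_minus field_simps)
      finally show "norm (exp (a * z) * \<kappa> z * ((exp (X i * z) - 1) / X i))
       \<le> \<bar>exp ((a + B) * z) * (z * \<kappa> z)\<bar> + \<bar>exp ((a - B) * z) * (z * \<kappa> z)\<bar>" .
    qed
  qed measurable
  then show "((\<lambda>h. ((\<integral>z. exp ((a + h) * z) * \<kappa> z \<partial>lborel) - (\<integral>z. exp (a * z) * \<kappa> z \<partial>lborel)) / h) \<circ> X)
      \<longlonglongrightarrow> (\<integral>z. exp (a * z) * (z * \<kappa> z) \<partial>lborel)"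
    by (simp only: o_def eq)
qed

end

section \<open>Smoothed densities and their second logarithmic derivative\<close>

context
  fixes f :: "real \<Rightarrow> real" and \<mu> :: real
  assumes good: "gauss_integrable f" and mu_pos: "0 < \<mu>"
begin

lemma gauss_integrable_measurable: "f \<in> borel_measurable borel"
  using good by (simp add: gauss_integrable_def)

lemma integrable_smoothed_moment:
  assumes "k \<le> 2"
  shows "integrable lborel (\<lambda>z. (z - u) ^ k * (f z * phi \<mu> (z - u)))"
proof (rule Bochner_Integration.integrable_bound)
  note [measurable] = gauss_integrable_measurable
  show "integrable lborel (\<lambda>z. (1 + 4 * \<mu>) * sqrt 2 * (f z * phi (2 * \<mu>) (z - u)))"
    using good mu_pos by (simp add: gauss_integrable_def)
  have "\<bar>(z - u) ^ k * (f z * phi \<mu> (z - u))\<bar> \<le> (1 + 4 * \<mu>) * sqrt 2 * (f z * phi (2 * \<mu>) (z - u))" for z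
    using mult_left_mono[OF power_mult_phi_le[OF mu_pos assms, of "z - u"], of "f z"] good
    by (simp add: gauss_integrable_def abs_mult power_abs mult_ac)
  then show "AE z in lborel. norm ((z - u) ^ k * (f z * phi \<mu> (z - u)))
      \<le> norm ((1 + 4 * \<mu>) * sqrt 2 * (f z * phi (2 * \<mu>) (z - u)))"
    using mu_pos by (auto intro!: AE_I2 order.trans[OF _ abs_ge_self])
  show "(\<lambda>z. (z - u) ^ k * (f z * phi \<mu> (z - u))) \<in> borel_measurable lborel"
    by measurable
qed

lemma smoothed_moment_0_nonneg: "0 \<le> smoothed_moment f 0 \<mu> u"
  unfolding smoothed_moment_def using good
  by (auto intro!: integral_nonneg_AE simp: gauss_integrable_def)

lemma smoothed_moment_0_eq_0_iff: "smoothed_moment f 0 \<mu> u = 0 \<longleftrightarrow> (AE z in lborel. f z = 0)"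
proof -
  have "smoothed_moment f 0 \<mu> u = 0 \<longleftrightarrow> (AE z in lborel. f z * phi \<mu> (z - u) = 0)"
    unfolding smoothed_moment_def using good integrable_smoothed_moment[of 0 u]
    by (subst integral_nonneg_eq_0_iff_AE) (auto simp: gauss_integrable_def)
  then show ?thesis using phi_pos[OF mu_pos] by (simp add: less_imp_neq[symmetric])
qed

text \<open>The Gaussian weight is positive everywhere, so one zero of the smoothed density forces
  \<open>f\<close> to vanish almost everywhere. A vanishing denominator is therefore accompanied by
  vanishing numerators, at every point \<open>v\<close>.\<close>

lemma smoothed_moment_eq_0:
  assumes "smoothed_moment f 0 \<mu> u = 0"
  shows "smoothed_moment f k \<mu> v = 0"
proof -
  have "AE z in lborel. f z = 0" using assms smoothed_moment_0_eq_0_iff by blast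
  then show ?thesis
    unfolding smoothed_moment_def by (intro integral_eq_zero_AE) (auto elim: AE_mp)
qed

text \<open>Nonnegativity of the variance of \<open>z - u\<close> under the weight
  \<open>f z * phi \<mu> (z - u)\<close>, with \<open>c\<close> as its mean.\<close>

lemma smoothed_moment_square_le:
  "(smoothed_moment f 1 \<mu> u)\<^sup>2 / smoothed_moment f 0 \<mu> u \<le> smoothed_moment f 2 \<mu> u"
proof (cases "smoothed_moment f 0 \<mu> u = 0")
  case True
  then show ?thesis using smoothed_moment_eq_0[OF True, of 2 u] by simp
next
  case False
  define c where "c = smoothed_moment f 1 \<mu> u / smoothed_moment f 0 \<mu> u"
  have eq: "(z - u - c)\<^sup>2 * (f z * phi \<mu> (z - u))
     = (z - u) ^ 2 * (f z * phi \<mu> (z - u)) - 2 * c * ((z - u) ^ 1 * (f z * phi \<mu> (z - u)))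
       + c\<^sup>2 * ((z - u) ^ 0 * (f z * phi \<mu> (z - u)))" for z
    by (simp add: power2_eq_square algebra_simps)
  have "0 \<le> (\<integral>z. (z - u - c)\<^sup>2 * (f z * phi \<mu> (z - u)) \<partial>lborel)"
    using good by (intro integral_nonneg_AE) (auto simp: gauss_integrable_def)
  also have "\<dots> = smoothed_moment f 2 \<mu> u - 2 * c * smoothed_moment f 1 \<mu> u + c\<^sup>2 * smoothed_moment f 0 \<mu> u"
    unfolding eq smoothed_moment_def
    using integrable_smoothed_moment[of 0 u] integrable_smoothed_moment[of 1 u] integrable_smoothed_moment[of 2 u]
    by simp
  also have "\<dots> = smoothed_moment f 2 \<mu> u - (smoothed_moment f 1 \<mu> u)\<^sup>2 / smoothed_moment f 0 \<mu> u"
    using False by (simp add: c_def power2_eq_square field_simps)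
  finally show ?thesis by simp
qed

text \<open>Up to the factor \<open>exp (- u\<^sup>2 / (2 * \<mu>))\<close> the smoothed density is a Laplace transform in \<open>u / \<mu>\<close>,
  which can be differentiated under the integral sign.\<close>

lemma second_deriv_ln_smoothed:
  defines "A k u \<equiv> smoothed_moment f k \<mu> u"
  shows "- deriv (deriv (\<lambda>u. ln (A 0 u))) u
    = (if A 0 u = 0 then 0 else 1 / \<mu> - (A 2 u / A 0 u - (A 1 u / A 0 u)\<^sup>2) / \<mu>\<^sup>2)"
proof (cases "A 0 u = 0")
  case True
  \<comment> \<open>The logarithm is then a constant function of \<open>u\<close>, whatever value
    \<open>ln 0\<close> has.\<close>
  then have "A 0 v = 0" for v unfolding A_def using smoothed_moment_eq_0 by blast
  then show ?thesis by simp
next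
  case False
  define \<kappa> where "\<kappa> z = f z * phi \<mu> z" for z
  have e: "exp (a * z) * \<kappa> z = exp (a\<^sup>2 * \<mu> / 2) * (f z * phi \<mu> (z - a * \<mu>))" for a z
    unfolding phi_shift[OF mu_pos, of z "a * \<mu>"] \<kappa>_def using mu_pos
    by (simp add: exp_minus power2_eq_square field_simps)
  have int0: "integrable lborel (\<lambda>z. exp (a * z) * \<kappa> z)" for a
    unfolding e using good mu_pos by (simp add: gauss_integrable_def)
  note int1 = integrable_exp_mult_ident[of \<kappa>, OF int0]
  note int2 = integrable_exp_mult_ident[of "\<lambda>z. z * \<kappa> z", OF int1]
  define L0 where "L0 a = (\<integral>z. exp (a * z) * \<kappa> z \<partial>lborel)" for a
  define L1 where "L1 a = (\<integral>z. exp (a * z) * (z * \<kappa> z) \<partial>lborel)" for a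
  define L2 where "L2 a = (\<integral>z. exp (a * z) * (z * (z * \<kappa> z)) \<partial>lborel)" for a
  have D0: "(L0 has_real_derivative L1 a) (at a)" for a
    unfolding L0_def[abs_def] L1_def by (rule DERIV_integral_exp[OF int0])
  have D1: "(L1 has_real_derivative L2 a) (at a)" for a
    unfolding L1_def[abs_def] L2_def by (rule DERIV_integral_exp[OF int1])
  define c where "c u = exp (- u\<^sup>2 / (2 * \<mu>))" for u
  have c: "0 < c u" for u by (simp add: c_def)
  have w: "f z * phi \<mu> (z - u) = c u * (exp (u / \<mu> * z) * \<kappa> z)" for z u
    unfolding phi_shift[OF mu_pos, of z u] \<kappa>_def c_def by simp
  have A0: "A 0 u = c u * L0 (u / \<mu>)" for u
    by (simp add: A_def smoothed_moment_def w L0_def)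
  have A1: "A 1 u = c u * (L1 (u / \<mu>) - u * L0 (u / \<mu>))" for u
  proof -
    have "(z - u) ^ 1 * (f z * phi \<mu> (z - u)) =
      c u * (exp (u / \<mu> * z) * (z * \<kappa> z) - u * (exp (u / \<mu> * z) * \<kappa> z))" for z
      by (simp add: w algebra_simps)
    then show ?thesis
      unfolding A_def smoothed_moment_def L0_def L1_def using int0[of "u / \<mu>"] int1[of "u / \<mu>"]
      by (simp only: Bochner_Integration.integral_mult_right_zero Bochner_Integration.integral_diff
          Bochner_Integration.integrable_mult_right)
  qed
  have A2: "A 2 u = c u * (L2 (u / \<mu>) - 2 * u * L1 (u / \<mu>) + u\<^sup>2 * L0 (u / \<mu>))" for u
  proof -
    have "(z - u)\<^sup>2 * (f z * phi \<mu> (z - u)) =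
      c u * (exp (u / \<mu> * z) * (z * (z * \<kappa> z)) - 2 * u * (exp (u / \<mu> * z) * (z * \<kappa> z))
        + u\<^sup>2 * (exp (u / \<mu> * z) * \<kappa> z))" for z
      by (simp add: w power2_eq_square algebra_simps)
    then show ?thesis
      unfolding A_def smoothed_moment_def L0_def L1_def L2_def
      using int0[of "u / \<mu>"] int1[of "u / \<mu>"] int2[of "u / \<mu>"]
      by (simp only: Bochner_Integration.integral_mult_right_zero Bochner_Integration.integral_diff
          Bochner_Integration.integral_add Bochner_Integration.integrable_mult_right
          Bochner_Integration.integrable_diff)
  qed
  have L0_pos: "0 < L0 a" for a
  proof -
    have "A 0 (a * \<mu>) \<noteq> 0" "0 \<le> A 0 (a * \<mu>)"
      using False smoothed_moment_eq_0 smoothed_moment_0_nonneg unfolding A_def by blast+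
    then have "0 < c (a * \<mu>) * L0 a" using A0[of "a * \<mu>"] mu_pos by (auto simp: less_le)
    then show ?thesis using c[of "a * \<mu>"] by (simp add: zero_less_mult_iff)
  qed
  \<comment> \<open>The quadratic term will contribute \<open>1 / \<mu>\<close>; the second
    logarithmic derivative of \<open>L0\<close> is the variance of the tilted law, and the inner
    factor \<open>1 / \<mu>\<close> enters squared.\<close>
  have ln: "ln (A 0 u) = - u\<^sup>2 / (2 * \<mu>) + ln (L0 (u / \<mu>))" for u
    using L0_pos[of "u / \<mu>"] by (simp add: A0 c_def ln_mult)
  have chain0: "((\<lambda>u. L0 (u / \<mu>)) has_real_derivative L1 (u / \<mu>) / \<mu>) (at u)" for u
    using DERIV_chain2[OF D0 DERIV_cdivide[OF DERIV_ident], of \<mu> u] by simp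
  have chain1: "((\<lambda>u. L1 (u / \<mu>)) has_real_derivative L2 (u / \<mu>) / \<mu>) (at u)" for u
    using DERIV_chain2[OF D1 DERIV_cdivide[OF DERIV_ident], of \<mu> u] by simp
  have "((\<lambda>u. ln (A 0 u)) has_real_derivative - u / \<mu> + L1 (u / \<mu>) / (\<mu> * L0 (u / \<mu>))) (at u)" for u
    unfolding ln using L0_pos[of "u / \<mu>"] mu_pos
    by (auto intro!: derivative_eq_intros chain0 simp: field_simps)
  then have d1: "deriv (\<lambda>u. ln (A 0 u)) = (\<lambda>u. - u / \<mu> + L1 (u / \<mu>) / (\<mu> * L0 (u / \<mu>)))"
    by (intro ext DERIV_imp_deriv)
  have "((\<lambda>u. - u / \<mu> + L1 (u / \<mu>) / (\<mu> * L0 (u / \<mu>))) has_real_derivative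
      - (1 / \<mu> - (L2 (u / \<mu>) / L0 (u / \<mu>) - (L1 (u / \<mu>) / L0 (u / \<mu>))\<^sup>2) / \<mu>\<^sup>2)) (at u)"
    using L0_pos[of "u / \<mu>"] mu_pos
    by (auto intro!: derivative_eq_intros chain0 chain1 simp: field_simps power2_eq_square)
  then have "- deriv (deriv (\<lambda>u. ln (A 0 u))) u
     = 1 / \<mu> - (L2 (u / \<mu>) / L0 (u / \<mu>) - (L1 (u / \<mu>) / L0 (u / \<mu>))\<^sup>2) / \<mu>\<^sup>2"
    unfolding d1 by (simp add: DERIV_imp_deriv)
  \<comment> \<open>Both sides are the same variance: the \<open>A k\<close> are moments about
    \<open>u\<close>, the \<open>L\<close> functions moments about 0, and a variance ignores the
    centre.\<close>
  moreover have "A 2 u / A 0 u - (A 1 u / A 0 u)\<^sup>2 = L2 (u / \<mu>) / L0 (u / \<mu>) - (L1 (u / \<mu>) / L0 (u / \<mu>))\<^sup>2"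
    unfolding A0 A1 A2 using L0_pos[of "u / \<mu>"] c[of u]
    by (simp add: field_simps power2_eq_square)
  ultimately show ?thesis using False by simp
qed

end

text \<open>Integrated over \<open>y\<close> first, the likelihood disappears and the total is 1 for
  each integer variance. So almost every \<open>y\<close> has finite integrals for all these
  countably many variances, and \<open>phi_shift_le\<close> passes to arbitrary \<open>\<mu>\<close>
  and \<open>u\<close>.\<close>

lemma AE_gauss_integrable:
  assumes "conditional_density \<nu> p"
  shows "AE y in \<nu>. gauss_integrable (p y)"
proof -
  interpret sigma_finite_measure \<nu> using assms by (simp add: conditional_density_def)
  interpret pair_sigma_finite \<nu> lborel ..
  have [measurable_cong]: "sets \<nu> = sets borel"
    and p_meas [measurable]: "(\<lambda>(y, z). p y z) \<in> borel_measurable (borel \<Otimes>\<^sub>M borel)"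
    and p_nonneg: "\<And>y z. 0 \<le> p y z" and p_int: "\<And>z. (\<integral>\<^sup>+y. ennreal (p y z) \<partial>\<nu>) = 1"
    using assms by (auto simp: conditional_density_def)
  have "AE y in \<nu>. (\<integral>\<^sup>+z. ennreal (p y z * phi (real n + 1) z) \<partial>lborel) \<noteq> \<infinity>" for n
  proof (rule nn_integral_noteq_infinite)
    have "(\<integral>\<^sup>+y. \<integral>\<^sup>+z. ennreal (p y z * phi (real n + 1) z) \<partial>lborel \<partial>\<nu>)
      = (\<integral>\<^sup>+z. \<integral>\<^sup>+y. ennreal (p y z * phi (real n + 1) z) \<partial>\<nu> \<partial>lborel)"
      by (rule Fubini'[symmetric]) measurable
    also have "\<dots> = (\<integral>\<^sup>+z. ennreal (phi (real n + 1) (z - 0)) \<partial>lborel)"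
      by (subst ennreal_mult) (simp_all add: p_nonneg nn_integral_multc[of "\<lambda>y. ennreal (p y _)"] p_int)
    also have "\<dots> = 1" by (rule nn_integral_phi) simp
    finally show "(\<integral>\<^sup>+y. \<integral>\<^sup>+z. ennreal (p y z * phi (real n + 1) z) \<partial>lborel \<partial>\<nu>) \<noteq> \<infinity>" by simp
  qed measurable
  then have "AE y in \<nu>. \<forall>n. (\<integral>\<^sup>+z. ennreal (p y z * phi (real n + 1) z) \<partial>lborel) \<noteq> \<infinity>"
    by (simp add: AE_all_countable)
  then show ?thesis
  proof eventually_elim
    case (elim y)
    have [measurable]: "p y \<in> borel_measurable borel" by measurable
    have "integrable lborel (\<lambda>z. p y z * phi \<mu> (z - u))" if "0 < \<mu>" for \<mu> u
    proof -
      obtain n :: nat where n: "2 * \<mu> \<le> real n" using real_arch_simple by blast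
      define C where "C = exp (u\<^sup>2 / (real n + 1)) * sqrt ((real n + 1) / \<mu>)"
      have "integrable lborel (\<lambda>z. p y z * phi (real n + 1) z)"
        using elim p_nonneg by (intro integrableI_nonneg) (auto simp: top.not_eq_extremum)
      then have "integrable lborel (\<lambda>z. C * (p y z * phi (real n + 1) z))" by simp
      then show ?thesis
      proof (rule Bochner_Integration.integrable_bound)
        have "p y z * phi \<mu> (z - u) \<le> C * (p y z * phi (real n + 1) z)" for z
          using mult_left_mono[OF phi_shift_le[OF that, of "real n + 1" z u] p_nonneg[of y z]] n
          by (simp add: C_def mult_ac)
        then show "AE z in lborel. norm (p y z * phi \<mu> (z - u)) \<le> norm (C * (p y z * phi (real n + 1) z))"
          using p_nonneg by (auto intro!: AE_I2 order.trans[OF _ abs_ge_self])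
      qed measurable
    qed
    then show ?case using p_nonneg by (simp add: gauss_integrable_def)
  qed
qed

text \<open>The derivative in \<open>u\<close> of the smoothed density is \<open>smoothed_moment f 1 \<mu> u / \<mu>\<close>, so this is the
  integrand of a Fisher information.\<close>

definition fisher_density :: "(real \<Rightarrow> real) \<Rightarrow> real \<Rightarrow> real \<Rightarrow> real" where
  "fisher_density f \<mu> u = (smoothed_moment f 1 \<mu> u / \<mu>)\<^sup>2 / smoothed_moment f 0 \<mu> u"

section \<open>Fisher information under Gaussian mixing\<close>

lemma smoothed_moment_pair_measurable:
  assumes [measurable]: "(\<lambda>(y, z). p y z) \<in> borel_measurable (borel \<Otimes>\<^sub>M borel)"
  shows "(\<lambda>(u, y). smoothed_moment (p y) k \<mu> u) \<in> borel_measurable (borel \<Otimes>\<^sub>M borel)"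
  unfolding smoothed_moment_def by measurable

text \<open>Once the square is completed, the mixture kernels have this form: the centre
  \<open>c z\<close> depends on \<open>z\<close>, but translation invariance removes it from the
  inner integral.\<close>

lemma integral_shifted_product:
  fixes g t c :: "real \<Rightarrow> real"
  assumes g: "integrable lborel g" and t: "integrable lborel t" and [measurable]: "c \<in> borel_measurable borel"
  shows "integrable (lborel \<Otimes>\<^sub>M lborel) (\<lambda>(z, w). g z * t (w - c z))"
    "(\<integral>w. \<integral>z. g z * t (w - c z) \<partial>lborel \<partial>lborel) = (\<integral>z. g z \<partial>lborel) * (\<integral>w. t w \<partial>lborel)"
proof -
  have [measurable]: "g \<in> borel_measurable borel" "t \<in> borel_measurable borel"
    using borel_measurable_integrable[OF g] borel_measurable_integrable[OF t] by simp_all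
  have shift: "integrable lborel (\<lambda>w. t (w - a))" "(\<integral>w. h (w - a) \<partial>lborel) = (\<integral>w. h w \<partial>lborel)"
    for a and h :: "real \<Rightarrow> real"
    using lborel_integrable_real_affine[OF t, of 1 "- a"] lborel_integral_real_affine[of 1 h "- a"]
    by simp_all
  show int: "integrable (lborel \<Otimes>\<^sub>M lborel) (\<lambda>(z, w). g z * t (w - c z))"
  proof (rule lborel_pair.Fubini_integrable)
    show "(\<lambda>(z, w). g z * t (w - c z)) \<in> borel_measurable (lborel \<Otimes>\<^sub>M lborel)"
      by measurable
  qed (use g shift shift(2)[where h = "\<lambda>w. \<bar>t w\<bar>"] in \<open>auto simp: abs_mult\<close>)
  have "(\<integral>w. \<integral>z. g z * t (w - c z) \<partial>lborel \<partial>lborel) = (\<integral>z. \<integral>w. g z * t (w - c z) \<partial>lborel \<partial>lborel)"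
    using lborel_pair.Fubini_integral[OF int] by simp
  then show "(\<integral>w. \<integral>z. g z * t (w - c z) \<partial>lborel \<partial>lborel) = (\<integral>z. g z \<partial>lborel) * (\<integral>w. t w \<partial>lborel)"
    by (simp add: shift(2))
qed

text \<open>Let \<open>v\<close> be the sum of independent normals of variances \<open>a\<close> and
  \<open>b - a\<close>. Then \<open>v\<close> has variance \<open>b\<close>, and given
  \<open>v\<close> the second summand \<open>w\<close> has mean \<open>v * (b - a) / b\<close> and
  variance \<open>a * (b - a) / b\<close>.\<close>

lemma phi_mult_phi:
  assumes "0 < a" "a < b"
  shows "phi a (v - w) * phi (b - a) w = phi b v * phi (a * (b - a) / b) (w - v * (b - a) / b)"
proof -
  define d where "d = b - a"
  have d: "0 < d" "b = a + d" "0 < b" using assms by (auto simp: d_def)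
  have "- (v - w)\<^sup>2 / (2 * a) + - w\<^sup>2 / (2 * d)
      = - v\<^sup>2 / (2 * b) + - (w - v * d / b)\<^sup>2 / (2 * (a * d / b))"
    using assms d(1) unfolding d(2) by (simp add: divide_simps) algebra
  then have "exp (- (v - w)\<^sup>2 / (2 * a)) * exp (- w\<^sup>2 / (2 * d))
      = exp (- v\<^sup>2 / (2 * b)) * exp (- (w - v * d / b)\<^sup>2 / (2 * (a * d / b)))"
    by (simp only: exp_add[symmetric])
  moreover have "sqrt (2 * pi * a) * sqrt (2 * pi * d) = sqrt (2 * pi * b) * sqrt (2 * pi * (a * d / b))"
    using d by (simp only: real_sqrt_mult[symmetric]) simp
  moreover have "0 < a * d / b" using assms d by simp
  ultimately show ?thesis
    unfolding d_def[symmetric] using assms d by (simp add: phi_eq)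
qed

text \<open>Smoothing by \<open>a\<close> and then by \<open>b - a\<close> is smoothing by
  \<open>b\<close>. The factor \<open>a / b\<close> appears because the derivative \<open>P'\<close>
  is the first moment divided by the variance: it is \<open>P'\<close> that mixes without a
  factor.\<close>

lemma smoothed_moment_mixture:
  assumes good: "gauss_integrable f" and ab: "0 < a" "a < b"
  shows "integrable lborel (\<lambda>w. phi (b - a) w * smoothed_moment f 0 a (u + w))"
    "(\<integral>w. phi (b - a) w * smoothed_moment f 0 a (u + w) \<partial>lborel) = smoothed_moment f 0 b u"
    "integrable lborel (\<lambda>w. phi (b - a) w * smoothed_moment f 1 a (u + w))"
    "(\<integral>w. phi (b - a) w * smoothed_moment f 1 a (u + w) \<partial>lborel) = a / b * smoothed_moment f 1 b u"
proof -
  have b: "0 < b" using ab by simp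
  define s where "s = a * (b - a) / b"
  have s: "0 < s" using ab b by (simp add: s_def)
  define c where "c z = (z - u) * (b - a) / b" for z
  define g where "g k z = (z - u) ^ k * (f z * phi b (z - u))" for k z
  have [measurable]: "c \<in> borel_measurable borel" by (simp add: c_def[abs_def])
  have g: "integrable lborel (g 0)" "integrable lborel (g 1)"
    using integrable_smoothed_moment[OF good b, of 0 u] integrable_smoothed_moment[OF good b, of 1 u]
    by (simp_all add: g_def[abs_def])
  have t: "integrable lborel (phi s)" "(\<integral>w. phi s w \<partial>lborel) = 1"
    "integrable lborel (\<lambda>w. w * phi s w)" "(\<integral>w. w * phi s w \<partial>lborel) = 0"
    using s phi_integral[of s 0] integrable_normal_moment_nz_1[of "sqrt s" 0] integral_normal_moment_nz_1[of "sqrt s" 0]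
    by (simp_all add: phi_def mult.commute)
  have K0: "phi (b - a) w * ((z - (u + w)) ^ 0 * (f z * phi a (z - (u + w)))) = g 0 z * phi s (w - c z)" for w z
    using phi_mult_phi[OF ab, of "z - u" w] by (simp add: g_def s_def c_def algebra_simps)
  \<comment> \<open>Splits \<open>z - u - w\<close> into its conditional mean
    \<open>a / b * (z - u)\<close> and the centred part \<open>c z - w\<close>, which integrates to
    0 over \<open>w\<close>.\<close>
  have K1: "phi (b - a) w * ((z - (u + w)) ^ 1 * (f z * phi a (z - (u + w))))
    = a / b * (g 1 z * phi s (w - c z)) - g 0 z * ((w - c z) * phi s (w - c z))" for w z
  proof -
    have "phi (b - a) w * ((z - (u + w)) ^ 1 * (f z * phi a (z - (u + w)))) = (z - u - w) * (g 0 z * phi s (w - c z))"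
      using K0[of w z] by (simp add: algebra_simps)
    moreover have "z - u - w = a / b * (z - u) - (w - c z)"
      using b by (simp add: c_def field_simps)
    moreover have "g 1 z = (z - u) * g 0 z" by (simp add: g_def)
    moreover have "(r * v - y) * (G * P) = r * (v * G * P) - G * (y * P)" for r v y G P :: real
      by (simp add: algebra_simps)
    ultimately show ?thesis by (simp only:)
  qed
  note P0 = integral_shifted_product[OF g(1) t(1), of c]
    and P1 = integral_shifted_product[OF g(2) t(1), of c]
    and P2 = integral_shifted_product[OF g(1) t(3), of c]
  have S0: "phi (b - a) w * smoothed_moment f 0 a (u + w) = (\<integral>z. g 0 z * phi s (w - c z) \<partial>lborel)" for w
    unfolding smoothed_moment_def K0[symmetric] by simp
  show "integrable lborel (\<lambda>w. phi (b - a) w * smoothed_moment f 0 a (u + w))"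
    unfolding S0 using lborel_pair.integrable_snd[OF P0(1)] by simp
  show "(\<integral>w. phi (b - a) w * smoothed_moment f 0 a (u + w) \<partial>lborel) = smoothed_moment f 0 b u"
    unfolding S0 using P0(2) t(2) by (simp add: smoothed_moment_def g_def)
  have S1: "phi (b - a) w * smoothed_moment f 1 a (u + w)
    = (\<integral>z. a / b * (g 1 z * phi s (w - c z)) - g 0 z * ((w - c z) * phi s (w - c z)) \<partial>lborel)" for w
    unfolding smoothed_moment_def K1[symmetric] by simp
  have K1_int: "integrable (lborel \<Otimes>\<^sub>M lborel)
      (\<lambda>(z, w). a / b * (g 1 z * phi s (w - c z)) - g 0 z * ((w - c z) * phi s (w - c z)))"
    using Bochner_Integration.integrable_diff[OF integrable_mult_right[OF P1(1), of "a / b"] P2(1)]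
    by (simp add: case_prod_beta')
  show "integrable lborel (\<lambda>w. phi (b - a) w * smoothed_moment f 1 a (u + w))"
    unfolding S1 using lborel_pair.integrable_snd[OF K1_int] by simp
  have "(\<integral>w. phi (b - a) w * smoothed_moment f 1 a (u + w) \<partial>lborel)
     = (\<integral>z. \<integral>w. a / b * (g 1 z * phi s (w - c z)) - g 0 z * ((w - c z) * phi s (w - c z)) \<partial>lborel \<partial>lborel)"
    unfolding S1 using lborel_pair.Fubini_integral[OF K1_int] by simp
  also have "\<dots> = (\<integral>z. a / b * g 1 z \<partial>lborel)"
  proof (rule Bochner_Integration.integral_cong[OF refl])
    fix z
    have sh: "integrable lborel (\<lambda>w. h (w - c z))" "(\<integral>w. h (w - c z) \<partial>lborel) = (\<integral>w. h w \<partial>lborel)"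
      if "integrable lborel h" for h :: "real \<Rightarrow> real"
      using lborel_integrable_real_affine[OF that, of 1 "- c z"] lborel_integral_real_affine[of 1 h "- c z"]
      by simp_all
    show "(\<integral>w. a / b * (g 1 z * phi s (w - c z)) - g 0 z * ((w - c z) * phi s (w - c z)) \<partial>lborel) = a / b * g 1 z"
      using sh[OF t(1)] sh[OF t(3)] t(2,4) by simp
  qed
  also have "\<dots> = a / b * smoothed_moment f 1 b u"
    by (simp add: smoothed_moment_def g_def)
  finally show "(\<integral>w. phi (b - a) w * smoothed_moment f 1 a (u + w) \<partial>lborel) = a / b * smoothed_moment f 1 b u" .
qed

text \<open>Cauchy-Schwarz, in the form \<open>x\<^sup>2 / y \<ge> 2 * c * x - c\<^sup>2 * y\<close> with equality for \<open>c = x / y\<close>: the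
  map \<open>(x, y) \<mapsto> x\<^sup>2 / y\<close> is convex, so mixing cannot increase the Fisher information.\<close>

lemma fisher_density_mixture_le:
  assumes good: "gauss_integrable f" and ab: "0 < a" "a < b"
    and meas: "(\<lambda>w. fisher_density f a (u + w)) \<in> borel_measurable borel"
  shows "ennreal (fisher_density f b u) \<le> (\<integral>\<^sup>+w. ennreal (fisher_density f a (u + w)) \<partial>gaussian (b - a))"
proof (cases "smoothed_moment f 0 b u = 0")
  case True
  then show ?thesis by (simp add: fisher_density_def)
next
  case False
  have b: "0 < b" using ab by simp
  define c where "c = smoothed_moment f 1 b u / b / smoothed_moment f 0 b u"
  define h where "h w = phi (b - a) w * (2 * c * (smoothed_moment f 1 a (u + w) / a) - c\<^sup>2 * smoothed_moment f 0 a (u + w))" for w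
  note mix = smoothed_moment_mixture[OF good ab, of u]
  have h_eq: "h w = 2 * c / a * (phi (b - a) w * smoothed_moment f 1 a (u + w))
      - c\<^sup>2 * (phi (b - a) w * smoothed_moment f 0 a (u + w))" for w
    by (simp add: h_def algebra_simps)
  have h_int: "integrable lborel h"
    unfolding h_eq[abs_def] using mix by auto
  have "(\<integral>w. h w \<partial>lborel) = 2 * c / a * (a / b * smoothed_moment f 1 b u) - c\<^sup>2 * smoothed_moment f 0 b u"
    unfolding h_eq using mix(1,3)
    by (simp only: Bochner_Integration.integral_diff Bochner_Integration.integral_mult_right_zero
        Bochner_Integration.integrable_mult_right mix(2,4))
  also have "\<dots> = fisher_density f b u"
    using False ab b by (simp add: c_def fisher_density_def power2_eq_square field_simps)
  finally have "ennreal (fisher_density f b u) = ennreal (\<integral>w. h w \<partial>lborel)" by simp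
  \<comment> \<open>The linear lower bound \<open>h\<close> may be negative, while the Fisher
    integrand may have infinite integral. The positive part still lies below the Fisher integrand
    and allows the passage to nonnegative integrals.\<close>
  also have "\<dots> \<le> ennreal (\<integral>w. max 0 (h w) \<partial>lborel)"
    using h_int by (intro ennreal_leI integral_mono integrable_max) auto
  also have "\<dots> = (\<integral>\<^sup>+w. ennreal (max 0 (h w)) \<partial>lborel)"
    using h_int by (subst nn_integral_eq_integral) (auto intro!: integrable_max)
  also have "\<dots> \<le> (\<integral>\<^sup>+w. ennreal (phi (b - a) w) * ennreal (fisher_density f a (u + w)) \<partial>lborel)"
  proof (rule nn_integral_mono)
    fix w
    define x y where "x = smoothed_moment f 1 a (u + w) / a" and "y = smoothed_moment f 0 a (u + w)"
    have "2 * c * x - c\<^sup>2 * y \<le> x\<^sup>2 / y"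
    proof (cases "y = 0")
      case True
      then show ?thesis
        using smoothed_moment_eq_0[OF good ab(1), of "u + w" 1 "u + w"] by (simp add: x_def y_def)
    next
      case False
      then have "0 < y" using smoothed_moment_0_nonneg[OF good ab(1), of "u + w"] by (simp add: y_def less_le)
      moreover have "0 \<le> (x - c * y)\<^sup>2" by simp
      ultimately show ?thesis by (simp add: field_simps power2_eq_square)
    qed
    then have "h w \<le> phi (b - a) w * fisher_density f a (u + w)"
      unfolding h_def fisher_density_def x_def y_def by (intro mult_left_mono) auto
    moreover have "0 \<le> fisher_density f a (u + w)"
      using smoothed_moment_0_nonneg[OF good ab(1)] by (simp add: fisher_density_def)
    ultimately show "ennreal (max 0 (h w)) \<le> ennreal (phi (b - a) w) * ennreal (fisher_density f a (u + w))"
      by (simp add: ennreal_mult[symmetric] ennreal_leI)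
  qed
  also have "\<dots> = (\<integral>\<^sup>+w. ennreal (fisher_density f a (u + w)) \<partial>gaussian (b - a))"
    using ab meas by (subst nn_integral_gaussian) auto
  finally show ?thesis .
qed

section \<open>Averages over the channel output\<close>

locale output_channel =
  fixes \<nu> :: "real measure" and p :: "real \<Rightarrow> real \<Rightarrow> real"
  assumes cond_density: "conditional_density \<nu> p"
begin

sublocale nu: sigma_finite_measure \<nu>
  using cond_density by (simp add: conditional_density_def)

lemma sets_nu [measurable_cong]: "sets \<nu> = sets borel"
  and p_measurable [measurable]: "(\<lambda>(y, z). p y z) \<in> borel_measurable (borel \<Otimes>\<^sub>M borel)"
  and p_nonneg: "0 \<le> p y z" and nn_integral_p: "(\<integral>\<^sup>+y. ennreal (p y z) \<partial>\<nu>) = 1"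
  using cond_density by (auto simp: conditional_density_def)

lemma sets_output_space [measurable_cong]:
  "sets (output_space \<nu> p m \<mu>) = sets ((borel \<Otimes>\<^sub>M borel) \<Otimes>\<^sub>M borel)"
  unfolding output_space_def bivariate_gaussian_def
  by (simp add: sets_nu cong: sets_pair_measure_cong)

text \<open>Given \<open>zh = u\<close>, the variable \<open>z\<close> is \<open>u\<close> plus
  noise of variance \<open>\<mu>\<close>. Integrating this noise out before \<open>y\<close> leaves
  the smoothed likelihood as the density of \<open>y\<close> given \<open>zh\<close>.\<close>

lemma nn_integral_output_space:
  assumes mu: "0 < \<mu>" "\<mu> \<le> m" and [measurable]: "F \<in> borel_measurable (borel \<Otimes>\<^sub>M borel)"
  shows "(\<integral>\<^sup>+((z, zh), y). F (zh, y) \<partial>output_space \<nu> p m \<mu>)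
    = (\<integral>\<^sup>+u. \<integral>\<^sup>+y. ennreal (smoothed_moment (p y) 0 \<mu> u) * F (u, y) \<partial>\<nu> \<partial>gaussian (m - \<mu>))"
proof -
  interpret g: prob_space "gaussian \<mu>" using mu by simp
  interpret pg: pair_sigma_finite "gaussian \<mu>" \<nu> ..
  have [measurable_cong]: "sets (bivariate_gaussian P) = sets (borel \<Otimes>\<^sub>M borel)" for P
    by (simp add: bivariate_gaussian_def)
  have "(\<integral>\<^sup>+((z, zh), y). F (zh, y) \<partial>output_space \<nu> p m \<mu>)
     = (\<integral>\<^sup>+w. (case w of ((z, zh), y) \<Rightarrow> ennreal (p y z) * F (zh, y)) \<partial>(bivariate_gaussian (P_z m \<mu>) \<Otimes>\<^sub>M \<nu>))"
    unfolding output_space_def by (subst nn_integral_density) (auto simp: case_prod_beta')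
  also have "\<dots> = (\<integral>\<^sup>+w. \<integral>\<^sup>+y. ennreal (p y (fst w)) * F (snd w, y) \<partial>\<nu> \<partial>bivariate_gaussian (P_z m \<mu>))"
    by (subst nu.nn_integral_fst[symmetric]) (auto simp: case_prod_beta')
  also have "\<dots> = (\<integral>\<^sup>+u. \<integral>\<^sup>+w. \<integral>\<^sup>+y. ennreal (p y (u + w)) * F (u, y) \<partial>\<nu> \<partial>gaussian \<mu> \<partial>gaussian (m - \<mu>))"
    using mu by (subst nn_integral_bivariate_gaussian_P_z) auto
  also have "\<dots> = (\<integral>\<^sup>+u. \<integral>\<^sup>+y. \<integral>\<^sup>+w. ennreal (p y (u + w)) * F (u, y) \<partial>gaussian \<mu> \<partial>\<nu> \<partial>gaussian (m - \<mu>))"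
    by (subst pg.Fubini') auto
  also have "\<dots> = (\<integral>\<^sup>+u. \<integral>\<^sup>+y. ennreal (smoothed_moment (p y) 0 \<mu> u) * F (u, y) \<partial>\<nu> \<partial>gaussian (m - \<mu>))"
  proof (rule nn_integral_cong, rule nn_integral_cong_AE)
    fix u
    show "AE y in \<nu>. (\<integral>\<^sup>+w. ennreal (p y (u + w)) * F (u, y) \<partial>gaussian \<mu>)
        = ennreal (smoothed_moment (p y) 0 \<mu> u) * F (u, y)"
      using AE_gauss_integrable[OF cond_density]
    proof eventually_elim
      case (elim y)
      have "(\<integral>\<^sup>+w. ennreal (p y (u + w)) * F (u, y) \<partial>gaussian \<mu>)
        = (\<integral>\<^sup>+w. ennreal (p y (u + w)) \<partial>gaussian \<mu>) * F (u, y)"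
        by (rule nn_integral_multc) measurable
      also have "(\<integral>\<^sup>+w. ennreal (p y (u + w)) \<partial>gaussian \<mu>)
         = (\<integral>\<^sup>+z. ennreal (phi \<mu> (z - u)) * ennreal (p y z) \<partial>lborel)"
        using mu by (intro nn_integral_gaussian_translate) auto
      also have "\<dots> = ennreal (smoothed_moment (p y) 0 \<mu> u)"
        using elim mu p_nonneg unfolding smoothed_moment_def gauss_integrable_def
        by (subst nn_integral_eq_integral[symmetric]) (auto simp: ennreal_mult mult.commute)
      finally show ?case .
    qed
  qed
  finally show ?thesis .
qed

text \<open>Integrating over \<open>y\<close> first leaves Gaussian moments. Together the two values
  say that \<open>A 2 / \<mu>^2 - A 0 / \<mu>\<close>, the second derivative of the density, has
  integral 0 over \<open>y\<close>, without differentiating under that integral.\<close>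

lemma nn_integral_smoothed_moment:
  assumes "0 < \<mu>"
  shows "(\<integral>\<^sup>+y. ennreal (smoothed_moment (p y) 0 \<mu> u) \<partial>\<nu>) = 1"
    "(\<integral>\<^sup>+y. ennreal (smoothed_moment (p y) 2 \<mu> u) \<partial>\<nu>) = ennreal \<mu>"
proof -
  interpret pair_sigma_finite \<nu> lborel ..
  have eq: "(\<integral>\<^sup>+y. ennreal (smoothed_moment (p y) k \<mu> u) \<partial>\<nu>)
      = (\<integral>\<^sup>+z. ennreal ((z - u) ^ k * phi \<mu> (z - u)) \<partial>lborel)" if "k = 0 \<or> k = 2" for k
  proof -
    have k: "k \<le> 2" "\<And>x::real. 0 \<le> x ^ k" using that by auto
    have "(\<integral>\<^sup>+y. ennreal (smoothed_moment (p y) k \<mu> u) \<partial>\<nu>)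
      = (\<integral>\<^sup>+y. \<integral>\<^sup>+z. ennreal (p y z) * ennreal ((z - u) ^ k * phi \<mu> (z - u)) \<partial>lborel \<partial>\<nu>)"
    proof (rule nn_integral_cong_AE)
      show "AE y in \<nu>. ennreal (smoothed_moment (p y) k \<mu> u)
         = (\<integral>\<^sup>+z. ennreal (p y z) * ennreal ((z - u) ^ k * phi \<mu> (z - u)) \<partial>lborel)"
        using AE_gauss_integrable[OF cond_density]
      proof eventually_elim
        case (elim y)
        show ?case
          unfolding smoothed_moment_def
          using integrable_smoothed_moment[OF elim assms k(1), of u] k(2) p_nonneg
          by (subst nn_integral_eq_integral[symmetric]) (auto simp: ennreal_mult[symmetric] mult_ac)
      qed
    qed
    also have "\<dots> = (\<integral>\<^sup>+z. \<integral>\<^sup>+y. ennreal (p y z) * ennreal ((z - u) ^ k * phi \<mu> (z - u)) \<partial>\<nu> \<partial>lborel)"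
      by (rule Fubini'[symmetric]) measurable
    also have "\<dots> = (\<integral>\<^sup>+z. ennreal ((z - u) ^ k * phi \<mu> (z - u)) \<partial>lborel)"
      by (subst nn_integral_multc) (simp_all add: nn_integral_p)
    finally show ?thesis .
  qed
  show "(\<integral>\<^sup>+y. ennreal (smoothed_moment (p y) 0 \<mu> u) \<partial>\<nu>) = 1"
    using nn_integral_phi[OF assms] by (simp add: eq)
  show "(\<integral>\<^sup>+y. ennreal (smoothed_moment (p y) 2 \<mu> u) \<partial>\<nu>) = ennreal \<mu>"
    using phi_second_moment[OF assms] by (simp add: eq)
qed

lemma distr_output_space:
  assumes mu: "0 < \<mu>" "\<mu> \<le> m"
  shows "distr (output_space \<nu> p m \<mu>) (borel \<Otimes>\<^sub>M borel) (\<lambda>((z, zh), y). (zh, y))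
    = density (gaussian (m - \<mu>) \<Otimes>\<^sub>M \<nu>) (\<lambda>w. ennreal (smoothed_moment (p (snd w)) 0 \<mu> (fst w)))"
proof (rule measure_eqI)
  fix A assume "A \<in> sets (distr (output_space \<nu> p m \<mu>) (borel \<Otimes>\<^sub>M borel) (\<lambda>((z, zh), y). (zh, y)))"
  then have [measurable]: "A \<in> sets (borel \<Otimes>\<^sub>M borel)" by simp
  have sets: "sets (gaussian (m - \<mu>) \<Otimes>\<^sub>M \<nu>) = sets (borel \<Otimes>\<^sub>M borel)"
    by (intro sets_pair_measure_cong sets_nu) simp
  have meas: "(\<lambda>w. ennreal (smoothed_moment (p (snd w)) 0 \<mu> (fst w)))
    \<in> borel_measurable (gaussian (m - \<mu>) \<Otimes>\<^sub>M \<nu>)"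
    using smoothed_moment_pair_measurable[OF p_measurable, of 0 \<mu>]
    unfolding measurable_cong_sets[OF sets refl] by (simp add: case_prod_beta')
  have "emeasure (distr (output_space \<nu> p m \<mu>) (borel \<Otimes>\<^sub>M borel) (\<lambda>((z, zh), y). (zh, y))) A
     = (\<integral>\<^sup>+((z, zh), y). indicator A (zh, y) \<partial>output_space \<nu> p m \<mu>)"
    by (subst nn_integral_indicator[symmetric], simp, subst nn_integral_distr)
      (auto simp: case_prod_beta')
  also have "\<dots> = (\<integral>\<^sup>+u. \<integral>\<^sup>+y. ennreal (smoothed_moment (p y) 0 \<mu> u) * indicator A (u, y) \<partial>\<nu> \<partial>gaussian (m - \<mu>))"
    by (rule nn_integral_output_space[OF mu]) measurable
  also have "\<dots> = (\<integral>\<^sup>+w. ennreal (smoothed_moment (p (snd w)) 0 \<mu> (fst w)) * indicator A w \<partial>(gaussian (m - \<mu>) \<Otimes>\<^sub>M \<nu>))"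
    using meas by (subst nu.nn_integral_fst[symmetric]) auto
  also have "\<dots> = emeasure (density (gaussian (m - \<mu>) \<Otimes>\<^sub>M \<nu>)
      (\<lambda>w. ennreal (smoothed_moment (p (snd w)) 0 \<mu> (fst w)))) A"
    using meas sets by (subst emeasure_density) auto
  finally show "emeasure (distr (output_space \<nu> p m \<mu>) (borel \<Otimes>\<^sub>M borel) (\<lambda>((z, zh), y). (zh, y))) A = \<dots>" .
next
  show "sets (distr (output_space \<nu> p m \<mu>) (borel \<Otimes>\<^sub>M borel) (\<lambda>((z, zh), y). (zh, y)))
    = sets (density (gaussian (m - \<mu>) \<Otimes>\<^sub>M \<nu>) (\<lambda>w. ennreal (smoothed_moment (p (snd w)) 0 \<mu> (fst w))))"
    using sets_pair_measure_cong[OF sets_gaussian sets_nu] by simp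
qed

lemma smoothed_moment_even_nonneg: "even k \<Longrightarrow> 0 \<le> smoothed_moment (p y) k \<mu> u"
  unfolding smoothed_moment_def using p_nonneg by (intro integral_nonneg_AE) auto

lemma D2_eq_smoothed_moment:
  assumes "0 < \<mu>" "gauss_integrable (p y)"
  shows "D2 p y u \<mu> = (if smoothed_moment (p y) 0 \<mu> u = 0 then 0 else
    1 / \<mu> - (smoothed_moment (p y) 2 \<mu> u / smoothed_moment (p y) 0 \<mu> u
      - (smoothed_moment (p y) 1 \<mu> u / smoothed_moment (p y) 0 \<mu> u)\<^sup>2) / \<mu>\<^sup>2)"
  using second_deriv_ln_smoothed[OF assms(2,1)] assms(1)
  by (simp add: D2_def p_Y_Zhat_eq_smoothed_moment)

lemma AE_pair_gauss_integrable: "AE w in N \<Otimes>\<^sub>M \<nu>. gauss_integrable (p (snd w))"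
proof -
  obtain B where B: "{y \<in> space \<nu>. \<not> gauss_integrable (p y)} \<subseteq> B" "emeasure \<nu> B = 0" "B \<in> sets \<nu>"
    using AE_E[OF AE_gauss_integrable[OF cond_density]] by blast
  show ?thesis
  proof (rule AE_I)
    show "{w \<in> space (N \<Otimes>\<^sub>M \<nu>). \<not> gauss_integrable (p (snd w))} \<subseteq> space N \<times> B"
      using B(1) by (auto simp: space_pair_measure)
  qed (use B in \<open>auto simp: nu.emeasure_pair_measure_Times\<close>)
qed

lemma ennreal_mean_D2:
  assumes mu: "0 < \<mu>" "\<mu> \<le> m"
    and D2_int: "integrable (output_space \<nu> p m \<mu>) (\<lambda>((z, zh), y). D2 p y zh \<mu>)"
  shows "ennreal (mean_D2 \<nu> p m \<mu>)
    = (\<integral>\<^sup>+u. \<integral>\<^sup>+y. ennreal (fisher_density (p y) \<mu> u) \<partial>\<nu> \<partial>gaussian (m - \<mu>))"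
proof -
  interpret g: prob_space "gaussian (m - \<mu>)" using mu by simp
  define M where "M = gaussian (m - \<mu>) \<Otimes>\<^sub>M \<nu>"
  define A where "A k w = smoothed_moment (p (snd w)) k \<mu> (fst w)" for k w
  define I where "I w = fisher_density (p (snd w)) \<mu> (fst w)" for w
  define E where "E w = (if A 0 w = 0 then 0 else 1 / \<mu> - (A 2 w / A 0 w - (A 1 w / A 0 w)\<^sup>2) / \<mu>\<^sup>2)" for w
  have sets_M [measurable_cong]: "sets M = sets (borel \<Otimes>\<^sub>M borel)"
    unfolding M_def by (intro sets_pair_measure_cong sets_nu) simp
  have A_meas [measurable]: "A k \<in> borel_measurable (borel \<Otimes>\<^sub>M borel)" for k
    using smoothed_moment_pair_measurable[OF p_measurable, of k \<mu>]
    by (simp add: A_def[abs_def] case_prod_beta')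
  have [measurable]: "E \<in> borel_measurable (borel \<Otimes>\<^sub>M borel)" "I \<in> borel_measurable (borel \<Otimes>\<^sub>M borel)"
    unfolding E_def[abs_def] I_def[abs_def] fisher_density_def A_def[symmetric] by measurable
  have A_nonneg: "even k \<Longrightarrow> 0 \<le> A k w" for k w
    by (simp add: A_def smoothed_moment_even_nonneg)
  have A_int: "integrable M (A k)" "(\<integral>w. A k w \<partial>M) = c"
    if "even k" "0 \<le> c" "\<And>u. (\<integral>\<^sup>+y. ennreal (smoothed_moment (p y) k \<mu> u) \<partial>\<nu>) = ennreal c" for k c
  proof -
    have "(\<integral>\<^sup>+w. ennreal (A k w) \<partial>M) = (\<integral>\<^sup>+u. \<integral>\<^sup>+y. ennreal (A k (u, y)) \<partial>\<nu> \<partial>gaussian (m - \<mu>))"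
      unfolding M_def by (subst nu.nn_integral_fst[symmetric]) (auto simp: M_def[symmetric])
    also have "\<dots> = ennreal c"
      using that(3) g.emeasure_space_1 by (simp add: A_def)
    finally have eq: "(\<integral>\<^sup>+w. ennreal (A k w) \<partial>M) = ennreal c" .
    then show "integrable M (A k)"
      using A_nonneg[OF that(1)] by (intro integrableI_nonneg) auto
    show "(\<integral>w. A k w \<partial>M) = c"
      using eq A_nonneg[OF that(1)] that(2) by (subst integral_eq_nn_integral) auto
  qed
  note A0 = A_int[of 0 1, simplified, OF nn_integral_smoothed_moment(1)[OF mu(1)]]
  note A2 = A_int[of 2 \<mu>, simplified, OF less_imp_le[OF mu(1)] nn_integral_smoothed_moment(2)[OF mu(1)]]
  have I_nonneg: "0 \<le> I w" for w
    using A_nonneg[of 0 w] by (simp add: I_def fisher_density_def A_def)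
  have AE_good': "AE w in M. gauss_integrable (p (snd w))"
    unfolding M_def by (rule AE_pair_gauss_integrable)
  \<comment> \<open>By Cauchy-Schwarz the Fisher integrand is at most
    \<open>A 2 w / \<mu>^2\<close>, whose integral is \<open>1 / \<mu>\<close>. Finiteness is what
    allows the mean of \<open>D2\<close> to be split into separate integrals.\<close>
  have I_int: "integrable M I"
  proof (rule Bochner_Integration.integrable_bound)
    show "integrable M (\<lambda>w. A 2 w / \<mu>\<^sup>2)" using A2 by simp
    show "AE w in M. norm (I w) \<le> norm (A 2 w / \<mu>\<^sup>2)"
      using AE_good'
    proof eventually_elim
      case (elim w)
      have "I w = (A 1 w)\<^sup>2 / A 0 w / \<mu>\<^sup>2"
        by (simp add: I_def fisher_density_def A_def power_divide)
      also have "\<dots> \<le> A 2 w / \<mu>\<^sup>2"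
        unfolding A_def using smoothed_moment_square_le[OF elim mu(1)] by (intro divide_right_mono) auto
      finally show ?case using I_nonneg[of w] A_nonneg[of 2 w] by simp
    qed
  qed measurable
  \<comment> \<open>\<open>D2\<close> is given by \<open>deriv\<close>, which does not display
    measurability; \<open>E\<close> is a measurable function equal to it for almost all
    \<open>y\<close>. The integrability hypothesis supplies the measurability of \<open>D2\<close>
    when the integrands are exchanged.\<close>
  have "AE w in output_space \<nu> p m \<mu>. (case w of ((z, zh), y) \<Rightarrow> D2 p y zh \<mu>) = (case w of ((z, zh), y) \<Rightarrow> E (zh, y))"
  proof -
    have [measurable_cong]: "sets (bivariate_gaussian P) = sets (borel \<Otimes>\<^sub>M borel)" for P
      by (simp add: bivariate_gaussian_def)
    have "AE w in bivariate_gaussian (P_z m \<mu>) \<Otimes>\<^sub>M \<nu>.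
        (case w of ((z, zh), y) \<Rightarrow> D2 p y zh \<mu>) = (case w of ((z, zh), y) \<Rightarrow> E (zh, y))"
      using AE_pair_gauss_integrable
      by eventually_elim (auto simp: D2_eq_smoothed_moment[OF mu(1)] E_def A_def)
    then show ?thesis
      unfolding output_space_def by (subst AE_density) (auto simp: case_prod_beta')
  qed
  then have "mean_D2 \<nu> p m \<mu> = (\<integral>((z, zh), y). E (zh, y) \<partial>output_space \<nu> p m \<mu>)"
    unfolding mean_D2_def
  proof (intro integral_cong_AE)
    show "(\<lambda>((z, zh), y). E (zh, y)) \<in> borel_measurable (output_space \<nu> p m \<mu>)"
      unfolding case_prod_beta' by measurable
  qed (use D2_int in auto)
  also have "\<dots> = (\<integral>w. E w \<partial>distr (output_space \<nu> p m \<mu>) (borel \<Otimes>\<^sub>M borel) (\<lambda>((z, zh), y). (zh, y)))"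
    by (subst integral_distr) (auto simp: case_prod_beta')
  also have "\<dots> = (\<integral>w. A 0 w * E w \<partial>M)"
    unfolding distr_output_space[OF mu] M_def[symmetric] A_def[symmetric]
    using A_nonneg[of 0] by (subst integral_density) auto
  \<comment> \<open>The first two terms are minus the second derivative; they integrate to
    \<open>1 / \<mu> - \<mu> / \<mu>^2 = 0\<close>.\<close>
  also have "\<dots> = (\<integral>w. A 0 w / \<mu> - A 2 w / \<mu>\<^sup>2 + I w \<partial>M)"
  proof (rule integral_cong_AE)
    show "AE w in M. A 0 w * E w = A 0 w / \<mu> - A 2 w / \<mu>\<^sup>2 + I w"
      using AE_good'
    proof eventually_elim
      case (elim w)
      show ?case
      proof (cases "A 0 w = 0")
        case True
        then show ?thesis
          using smoothed_moment_eq_0[OF elim mu(1), of "fst w" 2 "fst w"]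
          by (simp add: A_def I_def fisher_density_def)
      next
        case False
        then show ?thesis
          using mu(1) by (simp add: E_def I_def fisher_density_def A_def[symmetric] field_simps power2_eq_square)
      qed
    qed
  qed measurable
  also have "\<dots> = (\<integral>w. I w \<partial>M)"
    using A0 A2 I_int mu(1) by (simp add: power2_eq_square)
  finally have "ennreal (mean_D2 \<nu> p m \<mu>) = (\<integral>\<^sup>+w. ennreal (I w) \<partial>M)"
    using I_int I_nonneg by (simp add: nn_integral_eq_integral)
  also have "\<dots> = (\<integral>\<^sup>+u. \<integral>\<^sup>+y. ennreal (I (u, y)) \<partial>\<nu> \<partial>gaussian (m - \<mu>))"
    unfolding M_def by (subst nu.nn_integral_fst[symmetric]) (auto simp: M_def[symmetric])
  finally show ?thesis by (simp add: I_def)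
qed

text \<open>What the smoothing gains in variance from \<open>a\<close> to \<open>b\<close>, the law
  of \<open>zh\<close> loses: it goes from \<open>m - a\<close> to \<open>m - b\<close>. So the
  mixing noise of variance \<open>b - a\<close> given by convexity merges with \<open>zh\<close> at
  level \<open>b\<close> into exactly \<open>zh\<close> at level \<open>a\<close>.\<close>

lemma mean_D2_antimono:
  assumes ab: "0 < a" "a \<le> b" "b \<le> m"
    and int: "integrable (output_space \<nu> p m a) (\<lambda>((z, zh), y). D2 p y zh a)"
      "integrable (output_space \<nu> p m b) (\<lambda>((z, zh), y). D2 p y zh b)"
    and nonneg: "0 \<le> mean_D2 \<nu> p m a"
  shows "mean_D2 \<nu> p m b \<le> mean_D2 \<nu> p m a"
proof (cases "a = b")
  case False
  then have lt: "a < b" using ab by simp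
  interpret gd: prob_space "gaussian (b - a)" using lt by simp
  interpret pd: pair_sigma_finite "gaussian (b - a)" \<nu> ..
  have fd [measurable]: "(\<lambda>(u, y). fisher_density (p y) a u) \<in> borel_measurable (borel \<Otimes>\<^sub>M borel)"
  proof -
    note [measurable (raw)] = smoothed_moment_pair_measurable[OF p_measurable, unfolded case_prod_beta']
    show ?thesis unfolding fisher_density_def case_prod_beta' by measurable
  qed
  have "ennreal (mean_D2 \<nu> p m b)
     = (\<integral>\<^sup>+u. \<integral>\<^sup>+y. ennreal (fisher_density (p y) b u) \<partial>\<nu> \<partial>gaussian (m - b))"
    using ab lt by (intro ennreal_mean_D2[OF _ _ int(2)]) auto
  also have "\<dots> \<le> (\<integral>\<^sup>+u. \<integral>\<^sup>+y. \<integral>\<^sup>+w. ennreal (fisher_density (p y) a (u + w)) \<partial>gaussian (b - a) \<partial>\<nu> \<partial>gaussian (m - b))"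
  proof (rule nn_integral_mono, rule nn_integral_mono_AE)
    fix u
    show "AE y in \<nu>. ennreal (fisher_density (p y) b u)
        \<le> (\<integral>\<^sup>+w. ennreal (fisher_density (p y) a (u + w)) \<partial>gaussian (b - a))"
      using AE_gauss_integrable[OF cond_density]
      by eventually_elim (intro fisher_density_mixture_le ab lt; measurable)
  qed
  also have "\<dots> = (\<integral>\<^sup>+u. \<integral>\<^sup>+w. \<integral>\<^sup>+y. ennreal (fisher_density (p y) a (u + w)) \<partial>\<nu> \<partial>gaussian (b - a) \<partial>gaussian (m - b))"
    by (subst pd.Fubini') auto
  also have "\<dots> = (\<integral>\<^sup>+u. \<integral>\<^sup>+y. ennreal (fisher_density (p y) a u) \<partial>\<nu> \<partial>gaussian (m - a))"
    using ab by (subst nn_integral_gaussian_add) auto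
  also have "\<dots> = ennreal (mean_D2 \<nu> p m a)"
    using ab lt by (intro ennreal_mean_D2[OF _ _ int(1), symmetric]) auto
  finally show ?thesis using nonneg by (simp add: ennreal_le_iff)
qed simp

end

section \<open>Monotone iteration\<close>

text \<open>The range gives \<open>F b \<le> b\<close>, and monotonicity hands this down the
  iterates; continuity makes the limit a fixed point. Any fixed point starts below \<open>b\<close>
  and is kept below every iterate by monotonicity, hence below the limit. Everything starts at index
  1, since \<open>z 0\<close> is unconstrained.\<close>

lemma iteration_from_above:
  fixes F :: "real \<Rightarrow> real" and z :: "nat \<Rightarrow> real"
  assumes mono_F: "mono_on {a..b} F" and range_F: "F \<in> {a..b} \<rightarrow> {a..b}"
    and cont: "continuous_on {a..b} F" and "a \<le> b"
    and z: "z 1 = b" "\<And>t. 1 \<le> t \<Longrightarrow> z (Suc t) = F (z t)"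
  shows "\<And>t. 1 \<le> t \<Longrightarrow> a \<le> z t \<and> z t \<le> b" "antimono_on {1..} z"
    "\<exists>l. a \<le> l \<and> l \<le> b \<and> F l = l \<and> z \<longlonglongrightarrow> l \<and> (\<forall>x. a \<le> x \<longrightarrow> x \<le> b \<longrightarrow> F x = x \<longrightarrow> x \<le> l)"
proof -
  have mono: "F x \<le> F y" if "a \<le> x" "x \<le> y" "y \<le> b" for x y
    using mono_F that by (auto simp: monotone_on_def)
  have range: "a \<le> F x \<and> F x \<le> b" if "a \<le> x" "x \<le> b" for x
    using range_F that by auto
  show bounds: "a \<le> z t \<and> z t \<le> b" if "1 \<le> t" for t
    using that by (induction t rule: dec_induct) (use z range \<open>a \<le> b\<close> in auto)
  have step: "z (Suc t) \<le> z t" if "1 \<le> t" for t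
    using that
  proof (induction t rule: dec_induct)
    case base
    show ?case using bounds[of 2] z by (simp add: numeral_2_eq_2)
  next
    case (step t)
    then show ?case using mono[of "z (Suc t)" "z t"] bounds[of t] bounds[of "Suc t"] z(2)[of t] z(2)[of "Suc t"] by simp
  qed
  show anti: "antimono_on {1..} z"
  proof (rule monotone_onI)
    fix s t :: nat assume "s \<in> {1..}" "t \<in> {1..}" "s \<le> t"
    from \<open>s \<le> t\<close> show "z t \<le> z s"
      by (induction t rule: dec_induct) (use step \<open>s \<in> {1..}\<close> in \<open>auto intro: order.trans\<close>)
  qed
  have "decseq (\<lambda>n. z (Suc n))"
    using step by (intro decseq_SucI) simp
  then obtain l where "(\<lambda>n. z (Suc n)) \<longlonglongrightarrow> l"
    by (rule decseq_convergent[of _ a]) (use bounds in auto)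
  then have lim: "z \<longlonglongrightarrow> l" by (simp only: filterlim_sequentially_Suc)
  have ev: "\<forall>\<^sub>F t in sequentially. a \<le> z t \<and> z t \<le> b"
    using bounds by (auto simp: eventually_sequentially)
  then have l: "a \<le> l" "l \<le> b"
    using tendsto_lowerbound[OF lim, of a] tendsto_upperbound[OF lim, of b]
    by (simp_all add: eventually_conj_iff)
  have "(\<lambda>t. F (z t)) \<longlonglongrightarrow> F l"
    using continuous_on_tendsto_compose[OF cont lim] l ev by (auto elim: eventually_mono)
  moreover have "(\<lambda>t. F (z t)) \<longlonglongrightarrow> l"
  proof (rule Lim_transform_eventually)
    show "(\<lambda>t. z (Suc t)) \<longlonglongrightarrow> l" using lim by (simp only: filterlim_sequentially_Suc)
    show "\<forall>\<^sub>F t in sequentially. z (Suc t) = F (z t)" using z by (auto simp: eventually_sequentially)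
  qed
  ultimately have "F l = l" by (rule LIMSEQ_unique)
  moreover have "x \<le> l" if x: "a \<le> x" "x \<le> b" "F x = x" for x
  proof -
    have "x \<le> z t" if "1 \<le> t" for t
      using that
    proof (induction t rule: dec_induct)
      case (step t)
      then show ?case using mono[of x "z t"] bounds[of t] x z(2)[of t] by auto
    qed (use x z in simp)
    then show ?thesis
      by (intro tendsto_lowerbound[OF lim]) (auto simp: eventually_sequentially)
  qed
  ultimately show "\<exists>l. a \<le> l \<and> l \<le> b \<and> F l = l \<and> z \<longlonglongrightarrow> l \<and> (\<forall>x. a \<le> x \<longrightarrow> x \<le> b \<longrightarrow> F x = x \<longrightarrow> x \<le> l)"
    using l lim by blast
qed

text \<open>Conjugation with \<open>x \<mapsto> - x\<close> exchanges the endpoints and reverses the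
  order, which reduces this to the iteration from above.\<close>

lemma iteration_from_below:
  fixes F :: "real \<Rightarrow> real" and z :: "nat \<Rightarrow> real"
  assumes mono_F: "mono_on {a..b} F" and range_F: "F \<in> {a..b} \<rightarrow> {a..b}"
    and cont: "continuous_on {a..b} F" and "a \<le> b"
    and z: "z 1 = a" "\<And>t. 1 \<le> t \<Longrightarrow> z (Suc t) = F (z t)"
  shows "\<And>t. 1 \<le> t \<Longrightarrow> a \<le> z t \<and> z t \<le> b" "mono_on {1..} z"
    "\<exists>l. a \<le> l \<and> l \<le> b \<and> F l = l \<and> z \<longlonglongrightarrow> l \<and> (\<forall>x. a \<le> x \<longrightarrow> x \<le> b \<longrightarrow> F x = x \<longrightarrow> l \<le> x)"
proof -
  have neg_mono: "mono_on {- b..- a} (\<lambda>x. - F (- x))"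
    using mono_F by (auto simp: monotone_on_def)
  have neg_range: "(\<lambda>x. - F (- x)) \<in> {- b..- a} \<rightarrow> {- b..- a}"
    using range_F by (auto simp: Pi_iff)
  have neg_cont: "continuous_on {- b..- a} (\<lambda>x. - F (- x))"
    by (intro continuous_intros continuous_on_compose2[OF cont]) auto
  note neg = iteration_from_above[of "- b" "- a" "\<lambda>x. - F (- x)" "\<lambda>t. - z t", OF neg_mono neg_range neg_cont]
  have neg_bounds: "- b \<le> - z t \<and> - z t \<le> - a" if "1 \<le> t" for t
    by (rule neg(1)) (use assms that in auto)
  then show "a \<le> z t \<and> z t \<le> b" if "1 \<le> t" for t
    using that by force
  have "antimono_on {1..} (\<lambda>t. - z t)"
    by (rule neg(2)) (use assms in auto)
  then show "mono_on {1..} z"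
    by (simp add: monotone_on_def)
  have "\<exists>l. - b \<le> l \<and> l \<le> - a \<and> - F (- l) = l \<and> (\<lambda>t. - z t) \<longlonglongrightarrow> l
     \<and> (\<forall>x. - b \<le> x \<longrightarrow> x \<le> - a \<longrightarrow> - F (- x) = x \<longrightarrow> x \<le> l)"
    by (rule neg(3)) (use assms in auto)
  then obtain l where l: "- b \<le> l" "l \<le> - a" "- F (- l) = l" "(\<lambda>t. - z t) \<longlonglongrightarrow> l"
    and max: "\<And>x. - b \<le> x \<Longrightarrow> x \<le> - a \<Longrightarrow> - F (- x) = x \<Longrightarrow> x \<le> l"
    by blast
  show "\<exists>l. a \<le> l \<and> l \<le> b \<and> F l = l \<and> z \<longlonglongrightarrow> l \<and> (\<forall>x. a \<le> x \<longrightarrow> x \<le> b \<longrightarrow> F x = x \<longrightarrow> l \<le> x)"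
  proof (intro exI[of _ "- l"] conjI allI impI)
    show "z \<longlonglongrightarrow> - l" using tendsto_minus[OF l(4)] by simp
    show "- l \<le> x" if "a \<le> x" "x \<le> b" "F x = x" for x
      using max[of "- x"] that by simp
  qed (use l in auto)
qed

section \<open>The state evolution map\<close>

theorem theorem2:
  fixes pX pS \<nu> :: "real measure" and p :: "real \<Rightarrow> real \<Rightarrow> real" and \<beta> :: real
  assumes "real_distribution pX" and "integrable pX (\<lambda>x. x\<^sup>2)"
    and "real_distribution pS" and "AE s in pS. 0 < s" and "integrable pS (\<lambda>s. s)"
    and "conditional_density \<nu> p"
    and "0 \<le> \<beta>"
    and Ebar_out_defined: "\<And>\<mu>. 0 \<le> \<mu> \<Longrightarrow> \<mu> \<le> mu_z_init pX pS \<beta> \<Longrightarrow>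
      integrable (output_space \<nu> p (mu_z_init pX pS \<beta>) \<mu>) (\<lambda>((z, zh), y). D2 p y zh \<mu>) \<and>
      0 < mean_D2 \<nu> p (mu_z_init pX pS \<beta>) \<mu>"
    and "continuous_on {0..} (Ebar_in pX pS)"
    and "continuous_on {0..mu_z_init pX pS \<beta>} (Ebar_out \<nu> p (mu_z_init pX pS \<beta>))"
  shows "(\<exists>mq mx mz. SE_fixed_point pX pS \<nu> p \<beta> mq mx mz) \<and>
    (\<forall>\<mu>q \<mu>x \<mu>z. SE_equations pX pS \<nu> p \<beta> \<mu>q \<mu>x \<mu>z \<and> \<mu>z 1 = mu_z_init pX pS \<beta> \<longrightarrow>
      (\<exists>mq mx mz. largest_SE_fixed_point pX pS \<nu> p \<beta> mq mx mz \<and>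
        SE_decreases_to \<mu>q \<mu>x \<mu>z mq mx mz)) \<and>
    (\<forall>\<mu>q \<mu>x \<mu>z. SE_equations pX pS \<nu> p \<beta> \<mu>q \<mu>x \<mu>z \<and> \<mu>z 1 = 0 \<longrightarrow>
      (\<exists>mq mx mz. smallest_SE_fixed_point pX pS \<nu> p \<beta> mq mx mz \<and>
        SE_increases_to \<mu>q \<mu>x \<mu>z mq mx mz))"
proof -
  let ?m = "mu_z_init pX pS \<beta>"
  define out where "out = Ebar_out \<nu> p ?m"
  define F where "F x = \<beta> * Ebar_in pX pS (out x)" for x
  interpret X: square_integrable_law pX
    using assms(1,2) by (simp add: square_integrable_law_def square_integrable_law_axioms_def)
  interpret output_channel \<nu> p by unfold_locales fact
  note S = assms(3,4,5)
  have "0 \<le> mu_x_init pX" by (simp add: mu_x_init_def)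
  moreover have "0 \<le> (\<integral>s. s \<partial>pS)" using S(2) by (intro integral_nonneg_AE) (auto elim: eventually_mono)
  ultimately have m_nonneg: "0 \<le> ?m" using \<open>0 \<le> \<beta>\<close> by (simp add: mu_z_init_def)
  \<comment> \<open>The estimates for the input function hold at positive variance, so
    \<open>F\<close> is accessible only because the effective noise is positive, also at
    \<open>x = 0\<close>.\<close>
  have out_pos: "0 < out x" if "0 \<le> x" "x \<le> ?m" for x
    using Ebar_out_defined[OF that] by (simp add: out_def Ebar_out_def)
  have out_mono_pos: "out x \<le> out y" if "0 < x" "x \<le> y" "y \<le> ?m" for x y
    using mean_D2_antimono[of x y ?m] Ebar_out_defined[of x] Ebar_out_defined[of y] that
    by (simp add: out_def Ebar_out_def frac_le)
  have out_cont: "continuous_on {0..?m} out" using assms(10) by (simp add: out_def)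
  text \<open>At \<open>\<mu> = 0\<close> no smoothing is left and the Fisher information identity is not available, but
    continuity extends the monotonicity to this point.\<close>
  have out_mono: "out x \<le> out y" if "0 \<le> x" "x \<le> y" "y \<le> ?m" for x y
  proof (cases "x = 0 \<and> 0 < y")
    case True
    then have "(out \<longlongrightarrow> out 0) (at 0 within {0..?m})"
      using out_cont m_nonneg by (simp add: continuous_on_def)
    then have lim: "(out \<longlongrightarrow> out 0) (at 0 within {0..y})"
      by (rule tendsto_within_subset) (use that in auto)
    have "\<forall>\<^sub>F x in at 0 within {0..y}. out x \<le> out y"
      unfolding eventually_at_filter using out_mono_pos that by (auto intro!: always_eventually)
    moreover have "at 0 within {0..y} \<noteq> bot"
      using True by (simp add: at_within_Icc_at_right)
    ultimately show ?thesis using True tendsto_upperbound[OF lim] by blast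
  next
    case False
    then have "0 < x \<or> x = y" using that by auto
    then show ?thesis using that out_mono_pos by auto
  qed
  have F_mono: "mono_on {0..?m} F"
    unfolding F_def using \<open>0 \<le> \<beta>\<close>
    by (intro monotone_onI mult_left_mono X.Ebar_in_mono S out_pos out_mono) auto
  \<comment> \<open>The upper bound comes from the error being at most the variance of
    \<open>x\<close>: after averaging with weight \<open>s\<close> and multiplying by
    \<open>\<beta>\<close> it is exactly \<open>mu_z_init\<close>.\<close>
  have F_range: "F \<in> {0..?m} \<rightarrow> {0..?m}"
    using X.Ebar_in_bounds[OF S out_pos] \<open>0 \<le> \<beta>\<close>
    by (auto simp: F_def mu_z_init_def mult.assoc intro!: mult_left_mono)
  have F_cont: "continuous_on {0..?m} F"
    unfolding F_def
    by (intro continuous_intros continuous_on_compose2[OF assms(9) out_cont])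
      (auto dest!: out_pos)
  note hi = iteration_from_above[OF F_mono F_range F_cont m_nonneg]
  note lo = iteration_from_below[OF F_mono F_range F_cont m_nonneg]
  have fixed_point_iff: "SE_fixed_point pX pS \<nu> p \<beta> mq mx mz \<longleftrightarrow>
      0 \<le> mz \<and> mz \<le> ?m \<and> mq = out mz \<and> (\<forall>s>0. mx s = Ebar_in_s pX mq s) \<and> F mz = mz" for mq mx mz
    by (auto simp: SE_fixed_point_def F_def out_def)
  have limits: "\<mu>q \<longlonglongrightarrow> out l \<and> (\<forall>s>0. (\<lambda>t. \<mu>x t s) \<longlonglongrightarrow> Ebar_in_s pX (out l) s)"
    if SE: "SE_equations pX pS \<nu> p \<beta> \<mu>q \<mu>x \<mu>z"
      and bounds: "\<And>t. 1 \<le> t \<Longrightarrow> 0 \<le> \<mu>z t \<and> \<mu>z t \<le> ?m"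
      and l: "0 \<le> l" "l \<le> ?m" "\<mu>z \<longlonglongrightarrow> l" for \<mu>q \<mu>x \<mu>z l
  proof -
    have q: "\<mu>q t = out (\<mu>z t)" if "1 \<le> t" for t
      using SE that by (simp add: SE_equations_def out_def)
    have x: "\<mu>x (Suc t) s = Ebar_in_s pX (\<mu>q t) s" if "1 \<le> t" "0 < s" for t s
      using SE that by (simp add: SE_equations_def)
    have "(\<lambda>t. out (\<mu>z t)) \<longlonglongrightarrow> out l"
      using bounds l by (intro continuous_on_tendsto_compose[OF out_cont]) (auto simp: eventually_sequentially)
    then have lim_q: "\<mu>q \<longlonglongrightarrow> out l"
      by (rule Lim_transform_eventually) (auto simp: eventually_sequentially q intro!: exI[of _ 1])
    moreover have "(\<lambda>t. \<mu>x t s) \<longlonglongrightarrow> Ebar_in_s pX (out l) s" if "0 < s" for s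
    proof -
      \<comment> \<open>All noise levels lie between \<open>out 0\<close> and \<open>out ?m\<close>.
        Divided by \<open>s\<close> they fill a compact interval with positive left end, where
        \<open>mmse\<close> is continuous.\<close>
      have "0 < out 0 / s" using out_pos[of 0] m_nonneg that by simp
      note cont = X.mmse_continuous_on[OF this, of "out ?m / s"]
      have "(\<lambda>t. mmse pX (\<mu>q t / s)) \<longlonglongrightarrow> mmse pX (out l / s)"
      proof (rule continuous_on_tendsto_compose[OF cont])
        show "(\<lambda>t. \<mu>q t / s) \<longlonglongrightarrow> out l / s"
          using that by (intro tendsto_intros lim_q) auto
        show "out l / s \<in> {out 0 / s..out ?m / s}"
          using l out_mono that by (auto intro!: divide_right_mono)
        show "\<forall>\<^sub>F t in sequentially. \<mu>q t / s \<in> {out 0 / s..out ?m / s}"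
          using bounds out_mono that q
          by (auto simp: eventually_sequentially intro!: divide_right_mono exI[of _ 1])
      qed
      then have "(\<lambda>t. \<mu>x (Suc t) s) \<longlonglongrightarrow> Ebar_in_s pX (out l) s"
        unfolding Ebar_in_s_eq_mmse
        by (rule Lim_transform_eventually)
          (auto simp: eventually_sequentially x that Ebar_in_s_eq_mmse intro!: exI[of _ 1])
      then show ?thesis using LIMSEQ_offset[of "\<lambda>t. \<mu>x t s" 1] by simp
    qed
    ultimately show ?thesis by blast
  qed
  \<comment> \<open>Compares two times through the order of their \<open>\<mu>z\<close> values and
    not through the order of the times, so it serves the decreasing and the increasing case
    alike.\<close>
  have compare: "\<mu>q t \<le> \<mu>q t' \<and> (\<forall>s>0. \<mu>x (Suc t) s \<le> \<mu>x (Suc t') s)"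
    if SE: "SE_equations pX pS \<nu> p \<beta> \<mu>q \<mu>x \<mu>z"
      and bounds: "\<And>t. 1 \<le> t \<Longrightarrow> 0 \<le> \<mu>z t \<and> \<mu>z t \<le> ?m"
      and t: "1 \<le> t" "1 \<le> t'" and le: "\<mu>z t \<le> \<mu>z t'" for \<mu>q \<mu>x \<mu>z t t'
  proof -
    have eq: "\<mu>q t = out (\<mu>z t)" "\<mu>q t' = out (\<mu>z t')"
      "\<And>s. 0 < s \<Longrightarrow> \<mu>x (Suc t) s = Ebar_in_s pX (\<mu>q t) s"
      "\<And>s. 0 < s \<Longrightarrow> \<mu>x (Suc t') s = Ebar_in_s pX (\<mu>q t') s"
      using SE t by (simp_all add: SE_equations_def out_def)
    have "\<mu>q t \<le> \<mu>q t'" "0 < \<mu>q t"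
      unfolding eq(1,2) using out_mono out_pos le bounds[OF t(1)] bounds[OF t(2)] by auto
    then show ?thesis
      by (auto simp: eq(3,4) Ebar_in_s_eq_mmse intro!: X.mmse_mono divide_right_mono)
  qed
  have tail: "\<exists>s\<ge>1. t = Suc s" if "2 \<le> t" for t
    using that by (intro exI[of _ "t - 1"]) auto
  have z_step: "\<mu>z (Suc t) = F (\<mu>z t)" if "SE_equations pX pS \<nu> p \<beta> \<mu>q \<mu>x \<mu>z" "1 \<le> t" for \<mu>q \<mu>x \<mu>z t
    using that by (simp add: SE_equations_def F_def out_def)
  show ?thesis
  proof (intro conjI allI impI; (elim conjE)?)
    \<comment> \<open>Existence of a fixed point is taken from an explicit orbit; the exponent
      \<open>t - 1\<close> makes it start at index 1.\<close>
    have "(F ^^ (Suc t - 1)) ?m = F ((F ^^ (t - 1)) ?m)" if "1 \<le> t" for t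
      using that by (cases t) auto
    then obtain l where "0 \<le> l" "l \<le> ?m" "F l = l"
      using hi(3)[of "\<lambda>t. (F ^^ (t - 1)) ?m"] by auto
    then have "SE_fixed_point pX pS \<nu> p \<beta> (out l) (Ebar_in_s pX (out l)) l"
      by (simp add: fixed_point_iff)
    then show "\<exists>mq mx mz. SE_fixed_point pX pS \<nu> p \<beta> mq mx mz" by blast
  next
    fix \<mu>q \<mu>x \<mu>z
    assume SE: "SE_equations pX pS \<nu> p \<beta> \<mu>q \<mu>x \<mu>z" and init: "\<mu>z 1 = ?m"
    have bounds: "0 \<le> \<mu>z t \<and> \<mu>z t \<le> ?m" if "1 \<le> t" for t
      by (rule hi(1)[OF init z_step[OF SE] that])
    have z_mono: "antimono_on {1..} \<mu>z"
      by (rule hi(2)[OF init z_step[OF SE]])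
    obtain l where l: "0 \<le> l" "l \<le> ?m" "F l = l" "\<mu>z \<longlonglongrightarrow> l"
      and ext: "\<And>x. 0 \<le> x \<Longrightarrow> x \<le> ?m \<Longrightarrow> F x = x \<Longrightarrow> x \<le> l"
      using hi(3)[OF init z_step[OF SE]] by blast
    have "largest_SE_fixed_point pX pS \<nu> p \<beta> (out l) (Ebar_in_s pX (out l)) l"
      using l ext by (simp add: largest_SE_fixed_point_def fixed_point_iff)
    moreover have "antimono_on {1..} \<mu>q"
      using z_mono compare[OF SE bounds] by (simp add: monotone_on_def)
    moreover have "antimono_on {2..} (\<lambda>t. \<mu>x t s)" if "0 < s" for s
    proof (rule monotone_onI)
      fix t t' :: nat assume "t \<in> {2..}" "t' \<in> {2..}" "t \<le> t'"
      then obtain r r' where "1 \<le> r" "1 \<le> r'" "r \<le> r'" "t = Suc r" "t' = Suc r'"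
        using tail[of t] tail[of t'] by auto
      then show "\<mu>x t' s \<le> \<mu>x t s"
        using z_mono compare[OF SE bounds] that by (auto simp: monotone_on_def)
    qed
    ultimately show "\<exists>mq mx mz. largest_SE_fixed_point pX pS \<nu> p \<beta> mq mx mz \<and> SE_decreases_to \<mu>q \<mu>x \<mu>z mq mx mz"
      using z_mono l limits[OF SE bounds l(1,2,4)] unfolding SE_decreases_to_def by blast
  next
    fix \<mu>q \<mu>x \<mu>z
    assume SE: "SE_equations pX pS \<nu> p \<beta> \<mu>q \<mu>x \<mu>z" and init: "\<mu>z 1 = 0"
    have bounds: "0 \<le> \<mu>z t \<and> \<mu>z t \<le> ?m" if "1 \<le> t" for t
      by (rule lo(1)[OF init z_step[OF SE] that])
    have z_mono: "mono_on {1..} \<mu>z"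
      by (rule lo(2)[OF init z_step[OF SE]])
    obtain l where l: "0 \<le> l" "l \<le> ?m" "F l = l" "\<mu>z \<longlonglongrightarrow> l"
      and ext: "\<And>x. 0 \<le> x \<Longrightarrow> x \<le> ?m \<Longrightarrow> F x = x \<Longrightarrow> l \<le> x"
      using lo(3)[OF init z_step[OF SE]] by blast
    have "smallest_SE_fixed_point pX pS \<nu> p \<beta> (out l) (Ebar_in_s pX (out l)) l"
      using l ext by (simp add: smallest_SE_fixed_point_def fixed_point_iff)
    moreover have "mono_on {1..} \<mu>q"
      using z_mono compare[OF SE bounds] by (simp add: monotone_on_def)
    moreover have "mono_on {2..} (\<lambda>t. \<mu>x t s)" if "0 < s" for s
    proof (rule monotone_onI)
      fix t t' :: nat assume "t \<in> {2..}" "t' \<in> {2..}" "t \<le> t'"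
      then obtain r r' where "1 \<le> r" "1 \<le> r'" "r \<le> r'" "t = Suc r" "t' = Suc r'"
        using tail[of t] tail[of t'] by auto
      then show "\<mu>x t s \<le> \<mu>x t' s"
        using z_mono compare[OF SE bounds] that by (auto simp: monotone_on_def)
    qed
    ultimately show "\<exists>mq mx mz. smallest_SE_fixed_point pX pS \<nu> p \<beta> mq mx mz \<and> SE_increases_to \<mu>q \<mu>x \<mu>z mq mx mz"
      using z_mono l limits[OF SE bounds l(1,2,4)] unfolding SE_increases_to_def by blast
  qed
qed

end
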